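(* For an arbitrary permutation point set $X$, we have $\mathsf{OPT^R}(X)\le 2\cdot\mathsf{diam}(X)$.
   Context: For a permutation $(x_1,\dots,x_n)$ of $[n]$, $X=\{(x_i,i):i\in[n]\}$. Rectangulation: $S=\{0,\dots,n+1\}^2$, corner points $C=\{(0,0),(0,n+1),(n+1,0),(n+1,n+1)\}$, margin points $M=\{(i,0),(i,n+1),(0,i),(n+1,i):i\in[n]\}$, non-margin points $[n]\times[n]$. A state $(P,L)$: $P\subseteq S\setminus C$, $L$ a set of horizontal/vertical segments with endpoints in $P$; valid iff (i) each segment of $L$ contains exactly two points of $P$, its endpoints; (ii) no two segments intersect except at endpoints; (iii) each non-margin point of $P$ lies on at least two segments of $L$, and if on exactly two, they have the same orientation. Initial state: $P_0=X\cup M$, $L_0$ contains for each $(x,y)\in X$ the segments $[(x,0),(x,y)]$, $[(x,y),(x,n+1)]$. End state: valid $(P^*,L^* )$ with $P^*\supseteq P_0$, all segments horizontal, covering $\{0,\dots,n+1\}\times[n]$. A flip $\langle a,b\rangle$ sets $P'=P\cup\{a,b\}$, $L'=L\cup\{[a,b]\}$, splitting any segment containing $a$ (resp. $b$) in its interior at that point; valid if $[a,b]$ is axis-parallel and the result is valid; afterwards segments may be removed freely as long as validity is kept. $\mathsf{OPT^R}(X)$ is the minimum number of valid flips needed to go from the initial state to some end state. A-rotate: from a valid state, remove a segment $[x,y]\in L$ and add a segment $[x,z]$ of the other orientation; if $z$ is in the interior of some $[a,b]\in L$, replace it by $[a,z],[z,b]$; set $P'=P\cup\{z\}$; valid if the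 resulting state is valid. A-flip: remove two segments $[x,y],[y,z]\in L$ of the same orientation and add $[v,y],[y,w]$, both of the other orientation; split segments containing $v$ or $w$ in their interior at those points; $P'=P\cup\{v,w\}$; valid if the resulting state is valid. For two valid states $\mathcal{R}_1,\mathcal{R}_2$, $d(\mathcal{R}_1,\mathcal{R}_2)$ is the minimum number of valid A-rotate and A-flip operations transforming $\mathcal{R}_1$ into $\mathcal{R}_2$, and $\mathsf{diam}(X)=\max d(\mathcal{R}_1,\mathcal{R}_2)$ over all valid states $\mathcal{R}_1,\mathcal{R}_2$ reachable from the initial state determined by $X$. *)

theory Defs
  imports Main "HOL-Library.Extended_Nat"
begin

type_synonym point = "nat \<times> nat"

text \<open>
  The segment \<open>[a,b]\<close> is represented by its set of endpoints \<open>{a, b}\<close>, so that \<open>[a,b] = [b,a]\<close>.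
  Since all endpoints are grid points, it suffices to record the grid points lying on a segment:
  two different axis-parallel grid segments that meet in a point other than a common endpoint
  always have such a grid point in common.
\<close>

type_synonym segment = "point set"

definition horizontal :: "segment \<Rightarrow> bool" where
  "horizontal s \<longleftrightarrow> (\<exists>x1 x2 y. x1 < x2 \<and> s = {(x1, y), (x2, y)})"

definition vertical :: "segment \<Rightarrow> bool" where
  "vertical s \<longleftrightarrow> (\<exists>x y1 y2. y1 < y2 \<and> s = {(x, y1), (x, y2)})"

definition same_orientation :: "segment \<Rightarrow> segment \<Rightarrow> bool" where
  "same_orientation s t \<longleftrightarrow> horizontal s \<and> horizontal t \<or> vertical s \<and> vertical t"

definition other_orientation :: "segment \<Rightarrow> segment \<Rightarrow> bool" where
  "other_orientation s t \<longleftrightarrow> horizontal s \<and> vertical t \<or> vertical s \<and> horizontal t"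

text \<open>The grid points on a horizontal or vertical segment, endpoints included.\<close>

definition pts :: "segment \<Rightarrow> point set" where
  "pts s = {(x, y). \<exists>(x1, y1) \<in> s. \<exists>(x2, y2) \<in> s. x1 \<le> x \<and> x \<le> x2 \<and> y1 \<le> y \<and> y \<le> y2}"

definition inner :: "segment \<Rightarrow> point set" where
  "inner s = pts s - s"

definition permutation_points :: "nat \<Rightarrow> point set \<Rightarrow> bool" where
  "permutation_points n X \<longleftrightarrow>
     (\<exists>x. bij_betw x {1..n} {1..n} \<and> X = {(x i, i) | i. i \<in> {1..n}})"

definition grid :: "nat \<Rightarrow> point set" where
  "grid n = {0..n+1} \<times> {0..n+1}"

definition corners :: "nat \<Rightarrow> point set" where
  "corners n = {(0, 0), (0, n+1), (n+1, 0), (n+1, n+1)}"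

definition margin :: "nat \<Rightarrow> point set" where
  "margin n = (\<Union>i\<in>{1..n}. {(i, 0), (i, n+1), (0, i), (n+1, i)})"

type_synonym state = "point set \<times> segment set"

definition is_state :: "nat \<Rightarrow> state \<Rightarrow> bool" where
  "is_state n = (\<lambda>(P, L). P \<subseteq> grid n - corners n \<and>
     (\<forall>s\<in>L. (horizontal s \<or> vertical s) \<and> s \<subseteq> P))"

definition valid :: "nat \<Rightarrow> state \<Rightarrow> bool" where
  "valid n = (\<lambda>(P, L). is_state n (P, L) \<and>
     (\<forall>s\<in>L. pts s \<inter> P = s) \<and>
     (\<forall>s\<in>L. \<forall>t\<in>L. s \<noteq> t \<longrightarrow> pts s \<inter> pts t \<subseteq> s \<inter> t) \<and>
     (\<forall>p \<in> P \<inter> ({1..n} \<times> {1..n}).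
        2 \<le> card {s \<in> L. p \<in> pts s} \<and>
        (card {s \<in> L. p \<in> pts s} = 2 \<longrightarrow>
           (\<forall>s\<in>L. \<forall>t\<in>L. p \<in> pts s \<and> p \<in> pts t \<longrightarrow> same_orientation s t))))"

definition initial_state :: "nat \<Rightarrow> point set \<Rightarrow> state" where
  "initial_state n X =
     (X \<union> margin n, (\<Union>(x, y)\<in>X. {{(x, 0), (x, y)}, {(x, y), (x, n+1)}}))"

definition end_state :: "nat \<Rightarrow> point set \<Rightarrow> state \<Rightarrow> bool" where
  "end_state n X = (\<lambda>(P, L). valid n (P, L) \<and> X \<union> margin n \<subseteq> P \<and>
     (\<forall>s\<in>L. horizontal s) \<and> {0..n+1} \<times> {1..n} \<subseteq> (\<Union>s\<in>L. pts s))"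

definition split_at :: "point \<Rightarrow> segment set \<Rightarrow> segment set" where
  "split_at z L = {s \<in> L. z \<notin> inner s} \<union> {{u, z} | u s. s \<in> L \<and> z \<in> inner s \<and> u \<in> s}"

text \<open>
  One valid flip, together with the removal of segments that may follow it.
  Both the state directly after the flip and the one after the removal must be valid.
\<close>

definition flip_step :: "nat \<Rightarrow> state \<Rightarrow> state \<Rightarrow> bool" where
  "flip_step n = (\<lambda>(P, L) (P', L'). valid n (P, L) \<and>
     (\<exists>a b L1. (horizontal {a, b} \<or> vertical {a, b}) \<and>
        P' = P \<union> {a, b} \<and>
        L1 = split_at b (split_at a (L \<union> {{a, b}})) \<and> valid n (P', L1) \<and>
        L' \<subseteq> L1 \<and> valid n (P', L')))"

definition OPT_R :: "nat \<Rightarrow> point set \<Rightarrow> enat" where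
  "OPT_R n X = Inf {enat k | k. \<exists>R. (flip_step n ^^ k) (initial_state n X) R \<and> end_state n X R}"

definition A_rotate :: "nat \<Rightarrow> state \<Rightarrow> state \<Rightarrow> bool" where
  "A_rotate n = (\<lambda>(P, L) (P', L'). valid n (P, L) \<and>
     (\<exists>x y z. {x, y} \<in> L \<and> other_orientation {x, y} {x, z} \<and>
        P' = P \<union> {z} \<and>
        L' = split_at z ((L - {{x, y}}) \<union> {{x, z}})) \<and>
     valid n (P', L'))"

definition A_flip :: "nat \<Rightarrow> state \<Rightarrow> state \<Rightarrow> bool" where
  "A_flip n = (\<lambda>(P, L) (P', L'). valid n (P, L) \<and>
     (\<exists>x y z v w. {x, y} \<in> L \<and> {y, z} \<in> L \<and> x \<noteq> z \<and> v \<noteq> w \<and>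
        same_orientation {x, y} {y, z} \<and>
        other_orientation {x, y} {v, y} \<and> other_orientation {x, y} {y, w} \<and>
        P' = P \<union> {v, w} \<and>
        L' = split_at w (split_at v ((L - {{x, y}, {y, z}}) \<union> {{v, y}, {y, w}}))) \<and>
     valid n (P', L'))"

definition A_step :: "nat \<Rightarrow> state \<Rightarrow> state \<Rightarrow> bool" where
  "A_step n R R' \<longleftrightarrow> A_rotate n R R' \<or> A_flip n R R'"

definition A_dist :: "nat \<Rightarrow> state \<Rightarrow> state \<Rightarrow> enat" where
  "A_dist n R1 R2 = Inf {enat k | k. (A_step n ^^ k) R1 R2}"

text \<open>
  The operations never remove points from \<open>P\<close>, so a reachable state \<open>R1\<close> need not be
  transformable into another reachable state \<open>R2\<close>. The maximum is therefore taken over the pairs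
  for which \<open>R2\<close> can be obtained from \<open>R1\<close>, i.e. for which the distance is a minimum over a
  nonempty set. Admitting all pairs, with distance \<open>\<infinity>\<close> where there is no transformation, would
  only enlarge the diameter (and usually make it \<open>\<infinity>\<close>).
\<close>

definition diam :: "nat \<Rightarrow> point set \<Rightarrow> enat" where
  "diam n X = Sup {A_dist n R1 R2 | R1 R2.
     (A_step n)\<^sup>*\<^sup>* (initial_state n X) R1 \<and> (A_step n)\<^sup>*\<^sup>* (initial_state n X) R2 \<and>
     (A_step n)\<^sup>*\<^sup>* R1 R2}"

end

theory Submission
  imports Defs
begin

text \<open>
  Adding segments to a valid state without creating crossings keeps it valid, so an A-rotate is a
  flip of the new segment followed by the removal of the old one, and an A-flip is obtained from two
  flips, after which both old segments are removed. Hence a sequence of \<open>k\<close> operations gives at most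
  \<open>2 k\<close> flips, and it remains to reach an end state from the initial state by A-operations.
  For this one sweeps the columns from left to right. When column \<open>j\<close> is treated, the rows
  of the points further left end at it. Its outermost vertical segments are rotated
  to the right one by one, from both ends towards the point of \<open>X\<close> in that column, and the
  last two segments are then turned by an A-flip at this point.
\<close>

section \<open>Segments\<close>

text \<open>Two obstacles shape the proof. Every state between two flips has to be valid, while an
  A-flip may place \<open>v\<close> and \<open>w\<close> on the same side of \<open>y\<close>, or
  put \<open>v\<close> in the interior of a face; the two flips replacing it then cannot be made in
  an arbitrary order. The states holding both old and new segments get their validity from the
  target, to which the old segments are added. The second obstacle is that splitting obscures which
  segments a state consists of. The stages of the sweep therefore record only which unit edges of
  the grid are covered: cutting at grid points does not affect this, and validity at an interior
  point can be read off from the four unit edges around it. The A-flip in each column is forced. A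
  point of a row coming from the left already has a horizontal segment on one side, so one rotation
  makes that row pass straight through. The point of \<open>X\<close> has none, and turning only one
  of its vertical segments would leave it with one segment of each orientation.\<close>

abbreviation axis :: "segment \<Rightarrow> bool" where
  "axis s \<equiv> horizontal s \<or> vertical s"

lemma pts_horizontal: "a \<le> b \<Longrightarrow> pts {(a, y), (b, y)} = {a..b} \<times> {y}"
  by (auto simp: pts_def)

lemma pts_vertical: "a \<le> b \<Longrightarrow> pts {(x, a), (x, b)} = {x} \<times> {a..b}"
  by (auto simp: pts_def)

lemma axis_cases [consumes 1, case_names horizontal vertical]:
  assumes "axis s"
  obtains a b y where "a < b" "s = {(a, y), (b, y)}" "horizontal s" "\<not> vertical s"
      "pts s = {a..b} \<times> {y}"
  | x a b where "a < b" "s = {(x, a), (x, b)}" "vertical s" "\<not> horizontal s"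
      "pts s = {x} \<times> {a..b}"
proof -
  have *: "\<not> (horizontal s \<and> vertical s)"
    by (auto simp: horizontal_def vertical_def doubleton_eq_iff)
  show ?thesis
  proof (cases "horizontal s")
    case True
    then obtain a b y where "a < b" "s = {(a, y), (b, y)}"
      unfolding horizontal_def by blast
    with True * show ?thesis
      by (intro that(1)) (auto simp: pts_horizontal)
  next
    case False
    with assms obtain x a b where "a < b" "s = {(x, a), (x, b)}"
      unfolding vertical_def by blast
    with False assms show ?thesis
      by (intro that(2)) (auto simp: pts_vertical)
  qed
qed

lemma horizontal_pair: "a < b \<Longrightarrow> horizontal {(a, y), (b, y)}"
  by (auto simp: horizontal_def)

lemma vertical_pair: "a < b \<Longrightarrow> vertical {(x, a), (x, b)}"
  by (auto simp: vertical_def)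

lemma axis_endpoints: "axis s \<Longrightarrow> s \<subseteq> pts s"
  by (erule axis_cases) auto

lemma axis_doubleton:
  assumes "axis s" "u \<in> s"
  obtains u' where "s = {u, u'}" "u' \<noteq> u"
  using assms(1)
proof (cases rule: axis_cases)
  case (horizontal a b y)
  then show ?thesis using assms(2) that by (metis doubleton_eq_iff insertE less_irrefl prod.inject singletonD)
next
  case (vertical x a b)
  then show ?thesis using assms(2) that by (metis doubleton_eq_iff insertE less_irrefl prod.inject singletonD)
qed

lemma axis_distinct: "axis {a, b} \<Longrightarrow> a \<noteq> b"
  by (auto simp: horizontal_def vertical_def doubleton_eq_iff)

lemma orientation_exclusive: "axis s \<Longrightarrow> vertical s \<longleftrightarrow> \<not> horizontal s"
  by (erule axis_cases) auto

lemma inner_subset: "inner s \<subseteq> pts s"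
  by (auto simp: inner_def)

lemma cut_segment:
  assumes "axis {a, b}" "z \<in> inner {a, b}"
  shows "pts {a, z} \<union> pts {b, z} = pts {a, b}" "pts {a, z} \<inter> pts {b, z} = {z}"
    "horizontal {a, z} \<longleftrightarrow> horizontal {a, b}" "vertical {a, z} \<longleftrightarrow> vertical {a, b}"
proof -
  have "pts {a, z} \<union> pts {b, z} = pts {a, b} \<and> pts {a, z} \<inter> pts {b, z} = {z} \<and>
    (horizontal {a, z} \<longleftrightarrow> horizontal {a, b}) \<and> (vertical {a, z} \<longleftrightarrow> vertical {a, b})"
    using assms(1)
  proof (cases rule: axis_cases)
    case (horizontal c d y)
    then obtain e where e: "z = (e, y)" "c < e" "e < d"
      using assms(2) unfolding inner_def
      by (metis DiffE SigmaE atLeastAtMost_iff insert_iff le_neq_implies_less singletonD)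
    have "pts {(c, y), (e, y)} = {c..e} \<times> {y}" "pts {(d, y), (e, y)} = {e..d} \<times> {y}"
      using e pts_horizontal[of c e y] pts_horizontal[of e d y] by (auto simp: insert_commute)
    moreover have "horizontal {(c, y), (e, y)}" "horizontal {(d, y), (e, y)}"
      using e horizontal_pair[of c e y] horizontal_pair[of e d y] by (auto simp: insert_commute)
    moreover have "a = (c, y) \<and> b = (d, y) \<or> a = (d, y) \<and> b = (c, y)"
      using horizontal by (auto simp: doubleton_eq_iff)
    moreover have "\<not> vertical {(c, y), (e, y)}" "\<not> vertical {(d, y), (e, y)}"
      using calculation(3,4) orientation_exclusive by blast+
    moreover have "{c..e} \<times> {y} \<union> {e..d} \<times> {y} = {c..d} \<times> {y}"
      "({c..e} \<times> {y}) \<inter> ({e..d} \<times> {y}) = {(e, y)}"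
      using e by auto
    ultimately show ?thesis
      using horizontal e(1) by (elim disjE) (simp_all add: Un_commute Int_commute)
  next
    case (vertical x c d)
    then obtain e where e: "z = (x, e)" "c < e" "e < d"
      using assms(2) unfolding inner_def
      by (metis DiffE SigmaE atLeastAtMost_iff insert_iff le_neq_implies_less singletonD)
    have "pts {(x, c), (x, e)} = {x} \<times> {c..e}" "pts {(x, d), (x, e)} = {x} \<times> {e..d}"
      using e pts_vertical[of c e x] pts_vertical[of e d x] by (auto simp: insert_commute)
    moreover have "vertical {(x, c), (x, e)}" "vertical {(x, d), (x, e)}"
      using e vertical_pair[of c e x] vertical_pair[of e d x] by (auto simp: insert_commute)
    moreover have "a = (x, c) \<and> b = (x, d) \<or> a = (x, d) \<and> b = (x, c)"
      using vertical by (auto simp: doubleton_eq_iff)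
    moreover have "\<not> horizontal {(x, c), (x, e)}" "\<not> horizontal {(x, d), (x, e)}"
      using calculation(3,4) orientation_exclusive by blast+
    moreover have "{x} \<times> {c..e} \<union> {x} \<times> {e..d} = {x} \<times> {c..d}"
      "({x} \<times> {c..e}) \<inter> ({x} \<times> {e..d}) = {(x, e)}"
      using e by auto
    ultimately show ?thesis
      using vertical e(1) by (elim disjE) (simp_all add: Un_commute Int_commute)
  qed
  then show "pts {a, z} \<union> pts {b, z} = pts {a, b}" "pts {a, z} \<inter> pts {b, z} = {z}"
    "horizontal {a, z} \<longleftrightarrow> horizontal {a, b}" "vertical {a, z} \<longleftrightarrow> vertical {a, b}"
    by blast+
qed

text \<open>A row and a column share at most one grid point. In the simulation this keeps a removed
  segment clear of the segments that replace it.\<close>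

lemma perpendicular_meet:
  assumes "other_orientation {x, y} {x, z}"
  shows "pts {x, y} \<inter> pts {x, z} = {x}"
proof -
  have *: "pts s \<inter> pts t = {x}" if hv: "horizontal s" "vertical t" "x \<in> s" "x \<in> t" for s t
  proof -
    obtain a b r where s: "pts s = {a..b} \<times> {r}"
      using hv(1) by (metis horizontal_def less_imp_le pts_horizontal)
    obtain c d e where t: "pts t = {c} \<times> {d..e}"
      using hv(2) by (metis vertical_def less_imp_le pts_vertical)
    have "x \<in> pts s" "x \<in> pts t" using hv axis_endpoints by blast+
    then show ?thesis using s t by auto
  qed
  show ?thesis
    using assms *[of "{x, y}" "{x, z}"] *[of "{x, z}" "{x, y}"]
    unfolding other_orientation_def by auto
qed

section \<open>Planar states\<close>

text \<open>Conditions (i) and (ii) of validity. Intersections are only asked to lie in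
  \<open>P\<close>: a segment contains no points of \<open>P\<close> except its endpoints, so they
  are common endpoints automatically, and this form is easier to check for a new segment.\<close>

definition planar :: "nat \<Rightarrow> point set \<Rightarrow> segment set \<Rightarrow> bool" where
  "planar n P L \<longleftrightarrow> is_state n (P, L) \<and> (\<forall>s\<in>L. pts s \<inter> P = s) \<and>
     (\<forall>s\<in>L. \<forall>t\<in>L. s \<noteq> t \<longrightarrow> pts s \<inter> pts t \<subseteq> P)"

text \<open>Condition (iii) in a form that is visibly monotone in \<open>L\<close>, so that adding
  segments cannot destroy it.\<close>

definition good :: "segment set \<Rightarrow> point \<Rightarrow> bool" where
  "good L p \<longleftrightarrow> (\<exists>s\<in>L. \<exists>t\<in>L. s \<noteq> t \<and> p \<in> pts s \<and> p \<in> pts t \<and> same_orientation s t)"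

lemma finite_state: "is_state n (P, L) \<Longrightarrow> finite L"
proof -
  assume "is_state n (P, L)"
  then have "L \<subseteq> Pow (grid n)" by (auto simp: is_state_def)
  then show "finite L" by (rule finite_subset) (auto simp: grid_def)
qed

text \<open>Among three segments through a point two have the same orientation, so the cardinality
  condition of validity amounts to the existence of two segments of the same orientation.\<close>

lemma good_iff_card:
  assumes "is_state n (P, L)"
  shows "good L p \<longleftrightarrow> 2 \<le> card {s \<in> L. p \<in> pts s} \<and>
        (card {s \<in> L. p \<in> pts s} = 2 \<longrightarrow>
           (\<forall>s\<in>L. \<forall>t\<in>L. p \<in> pts s \<and> p \<in> pts t \<longrightarrow> same_orientation s t))"
    (is "_ \<longleftrightarrow> 2 \<le> card ?S \<and> ?R")
proof -
  have fin: "finite ?S" using finite_state[OF assms] by simp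
  have ax: "axis s" if "s \<in> L" for s using assms that by (auto simp: is_state_def)
  show ?thesis
  proof
    assume "good L p"
    then obtain s t where st: "s \<in> ?S" "t \<in> ?S" "s \<noteq> t" "same_orientation s t"
      unfolding good_def by blast
    then have sub: "{s, t} \<subseteq> ?S" and c: "card {s, t} = 2" by auto
    have "2 \<le> card ?S" using card_mono[OF fin sub] c by simp
    moreover have ?R
    proof
      assume "card ?S = 2"
      then have eq: "?S = {s, t}" using card_subset_eq[OF fin sub] c by simp
      have "same_orientation u v" if "u \<in> ?S" "v \<in> ?S" for u v
        using that st(4) unfolding eq same_orientation_def by blast
      then show "\<forall>s\<in>L. \<forall>t\<in>L. p \<in> pts s \<and> p \<in> pts t \<longrightarrow> same_orientation s t" by blast
    qed
    ultimately show "2 \<le> card ?S \<and> ?R" by blast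
  next
    assume *: "2 \<le> card ?S \<and> ?R"
    show "good L p"
    proof (cases "card ?S = 2")
      case True
      then obtain s t where "?S = {s, t}" "s \<noteq> t" by (auto simp: card_2_iff)
      then have "s \<in> ?S" "t \<in> ?S" "s \<noteq> t" by blast+
      with * True show ?thesis unfolding good_def by blast
    next
      case False
      with * have "3 \<le> card ?S" by linarith
      then obtain T where "T \<subseteq> ?S" "card T = 3" by (meson obtain_subset_with_card_n)
      then obtain s t u where "s \<in> ?S" "t \<in> ?S" "u \<in> ?S" "s \<noteq> t" "s \<noteq> u" "t \<noteq> u"
        by (auto simp: card_3_iff)
      then show ?thesis unfolding good_def same_orientation_def using ax by blast
    qed
  qed
qed

lemma planar_endpoint: "planar n P L \<Longrightarrow> s \<in> L \<Longrightarrow> p \<in> P \<Longrightarrow> p \<in> pts s \<Longrightarrow> p \<in> s"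
  by (auto simp: planar_def)

lemma planar_axis: "planar n P L \<Longrightarrow> s \<in> L \<Longrightarrow> axis s"
  by (auto simp: planar_def is_state_def)

lemma planar_subset: "planar n P L \<Longrightarrow> s \<in> L \<Longrightarrow> s \<subseteq> P"
  by (auto simp: planar_def is_state_def)

lemma planar_meet:
  "planar n P L \<Longrightarrow> s \<in> L \<Longrightarrow> t \<in> L \<Longrightarrow> s \<noteq> t \<Longrightarrow> p \<in> pts s \<Longrightarrow> p \<in> pts t \<Longrightarrow> p \<in> s \<inter> t"
  by (meson IntI planar_def planar_endpoint subsetD)

lemma planar_mono: "planar n P L \<Longrightarrow> L' \<subseteq> L \<Longrightarrow> planar n P L'"
  unfolding planar_def is_state_def prod.case by (meson subsetD)

lemma planar_insert:
  assumes "planar n P L" "axis s" "pts s \<inter> P = s"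
    and "\<And>t. t \<in> L \<Longrightarrow> t \<noteq> s \<Longrightarrow> pts s \<inter> pts t \<subseteq> P"
  shows "planar n P (insert s L)"
proof -
  have "s \<subseteq> P" using assms(3) by blast
  then have "is_state n (P, insert s L)" "\<forall>t\<in>insert s L. pts t \<inter> P = t"
    using assms(1-3) by (simp_all add: planar_def is_state_def)
  moreover have "pts t \<inter> pts u \<subseteq> P" if "t \<in> insert s L" "u \<in> insert s L" "t \<noteq> u" for t u
  proof -
    have "t = s \<and> u \<in> L \<or> u = s \<and> t \<in> L \<or> t \<in> L \<and> u \<in> L" using that by blast
    then show ?thesis
      using assms(1,4) that(3) unfolding planar_def by (metis Int_commute)
  qed
  ultimately show ?thesis by (simp add: planar_def)
qed

lemma valid_iff:
  "valid n (P, L) \<longleftrightarrow> planar n P L \<and> (\<forall>p \<in> P \<inter> ({1..n} \<times> {1..n}). good L p)"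
proof -
  have "is_state n (P, L) \<and> (\<forall>s\<in>L. pts s \<inter> P = s) \<and>
      (\<forall>s\<in>L. \<forall>t\<in>L. s \<noteq> t \<longrightarrow> pts s \<inter> pts t \<subseteq> s \<inter> t) \<longleftrightarrow> planar n P L" (is "?A \<longleftrightarrow> _")
  proof
    assume A: ?A
    have "pts s \<inter> pts t \<subseteq> P" if "s \<in> L" "t \<in> L" "s \<noteq> t" for s t
    proof -
      have "pts s \<inter> pts t \<subseteq> s" "pts s \<inter> P = s" using A that by blast+
      then show ?thesis by blast
    qed
    with A show "planar n P L" unfolding planar_def by blast
  next
    assume pl: "planar n P L"
    have "pts s \<inter> pts t \<subseteq> s \<inter> t" if "s \<in> L" "t \<in> L" "s \<noteq> t" for s t
      using planar_meet[OF pl that] by blast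
    with pl show ?A unfolding planar_def by blast
  qed
  note planar_eq = this
  show ?thesis
  proof (cases "planar n P L")
    case True
    then have "is_state n (P, L)" by (simp add: planar_def)
    with True planar_eq show ?thesis
      by (simp add: valid_def good_iff_card)
  next
    case False
    then show ?thesis using planar_eq by (auto simp: valid_def)
  qed
qed

lemma good_mono: "good L p \<Longrightarrow> L \<subseteq> L' \<Longrightarrow> good L' p"
  unfolding good_def by blast

section \<open>Cutting segments at a grid point\<close>

lemma split_at_Un: "split_at z (L \<union> M) = split_at z L \<union> split_at z M"
  unfolding split_at_def by blast

lemma split_at_insert: "split_at z (insert s L) = split_at z {s} \<union> split_at z L"
  by (auto simp: split_at_def)

lemma split_at_outside: "z \<notin> inner s \<Longrightarrow> split_at z {s} = {s}"
  by (auto simp: split_at_def)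

lemma split_at_inside: "z \<in> inner {a, b} \<Longrightarrow> split_at z {{a, b}} = {{a, z}, {b, z}}"
  unfolding split_at_def by blast

lemma split_at_id: "(\<And>s. s \<in> L \<Longrightarrow> z \<notin> inner s) \<Longrightarrow> split_at z L = L"
  by (auto simp: split_at_def)

lemma planar_not_inner: "planar n P L \<Longrightarrow> z \<in> P \<Longrightarrow> s \<in> L \<Longrightarrow> z \<notin> inner s"
  by (auto simp: planar_def inner_def)

lemma endpoint_not_inner: "z \<in> s \<Longrightarrow> z \<notin> inner s"
  by (auto simp: inner_def)

lemma split_at_iff:
  "t \<in> split_at z L \<longleftrightarrow>
     t \<in> L \<and> z \<notin> inner t \<or> (\<exists>s\<in>L. \<exists>u\<in>s. z \<in> inner s \<and> t = {u, z})"
  unfolding split_at_def by blast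

lemma split_at_piece:
  assumes "t \<in> split_at z L" "\<forall>s\<in>L. axis s"
  obtains "t \<in> L" "z \<notin> inner t"
  | u u' where "{u, u'} \<in> L" "z \<in> inner {u, u'}" "t = {u, z}" "u' \<noteq> u"
proof (cases "t \<in> L \<and> z \<notin> inner t")
  case True
  then show ?thesis using that(1) by blast
next
  case False
  then obtain u s where us: "s \<in> L" "z \<in> inner s" "u \<in> s" "t = {u, z}"
    using assms(1) unfolding split_at_iff by blast
  moreover have "axis s" using assms(2) us(1) by blast
  then obtain u' where "s = {u, u'}" "u' \<noteq> u" using us(3) by (rule axis_doubleton)
  ultimately show ?thesis using that(2)[of u u'] by metis
qed

lemma split_at_source:
  assumes "t \<in> split_at z L" "\<forall>s\<in>L. axis s"
  obtains s where "s \<in> L" "pts t \<subseteq> pts s" "axis t" "t \<subseteq> insert z s"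
  using assms
proof (cases rule: split_at_piece)
  case 1
  show ?thesis by (rule that[of t]) (use 1 assms(2) in auto)
next
  case (2 u u')
  then have "axis {u, u'}" using assms(2) by blast
  note cut = cut_segment[OF this 2(2)]
  show ?thesis
  proof (rule that[OF 2(1)])
    show "pts t \<subseteq> pts {u, u'}" using cut(1) 2(3) by blast
    show "axis t" using cut(3,4) 2(3) \<open>axis {u, u'}\<close> by simp
    show "t \<subseteq> insert z {u, u'}" using 2(3) by simp
  qed
qed

lemma split_at_subset: "t \<in> split_at z {s} \<Longrightarrow> axis s \<Longrightarrow> pts t \<subseteq> pts s"
  by (erule split_at_source) auto

text \<open>The last conclusion serves to tell the piece through \<open>p\<close> apart from a given
  segment that differs from \<open>s\<close> and avoids \<open>z\<close>.\<close>

lemma split_at_cover: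
  assumes "s \<in> L" "p \<in> pts s" "axis s"
  obtains t where "t \<in> split_at z L" "p \<in> pts t" "t = s \<or> z \<in> t"
proof (cases "z \<in> inner s")
  case False
  then show ?thesis using that assms by (auto simp: split_at_def)
next
  case True
  obtain u where "u \<in> s" using assms(3) by (cases rule: axis_cases) auto
  then obtain u' where u': "s = {u, u'}" using axis_doubleton assms by metis
  have "{u, z} \<in> split_at z L" "{u', z} \<in> split_at z L"
    using True assms(1) u' unfolding split_at_iff by blast+
  moreover have "p \<in> pts {u, z} \<union> pts {u', z}"
    using cut_segment(1)[of u u' z] u' assms True by simp
  ultimately show ?thesis using that[of "{u, z}"] that[of "{u', z}"] by (metis UnE insertCI)
qed

text \<open>Pieces of different segments meet only where those segments do, and the two pieces of
  one segment meet only in \<open>z\<close>, which now belongs to the point set.\<close>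

lemma planar_split:
  assumes pl: "planar n P L" and z: "z \<in> grid n - corners n"
  shows "planar n (insert z P) (split_at z L)"
proof -
  have ax': "\<forall>s\<in>L. axis s" using planar_axis[OF pl] by simp
  then have ax: "\<And>s. s \<in> L \<Longrightarrow> axis s" by simp
  have 1: "is_state n (insert z P, split_at z L)"
  proof -
    have "axis t \<and> t \<subseteq> insert z P" if "t \<in> split_at z L" for t
      using that ax'
    proof (cases rule: split_at_source)
      case (1 s)
      then show ?thesis using planar_subset[OF pl, of s] by auto
    qed
    moreover have "P \<subseteq> grid n - corners n" using pl by (auto simp: planar_def is_state_def)
    ultimately show ?thesis using z by (auto simp: is_state_def)
  qed
  have 2: "pts t \<inter> insert z P = t" if t: "t \<in> split_at z L" for t
    using t ax'
  proof (cases rule: split_at_piece)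
    case 1
    then show ?thesis using pl axis_endpoints[OF ax, of t] by (auto simp: planar_def inner_def)
  next
    case (2 u u')
    note cut = cut_segment[OF ax[OF 2(1)] 2(2)]
    have "u' \<in> pts {u', z}"
      using cut_segment(3,4)[of u' u z] ax[OF 2(1)] 2(2) axis_endpoints[of "{u', z}"]
      by (auto simp: insert_commute)
    moreover have "u' \<noteq> z" using 2(2) by (auto simp: inner_def)
    ultimately have "u' \<notin> pts {u, z}" using cut(2) by blast
    moreover have "pts {u, u'} \<inter> P = {u, u'}" using pl 2(1) by (auto simp: planar_def)
    moreover have "{u, z} \<subseteq> pts {u, z}"
      using cut(3,4) ax[OF 2(1)] axis_endpoints[of "{u, z}"] by blast
    ultimately show ?thesis using cut(1) 2(3) by blast
  qed
  have 3: "pts t \<inter> pts t' \<subseteq> insert z P"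
    if t: "t \<in> split_at z L" "t' \<in> split_at z L" "t \<noteq> t'" for t t'
  proof -
    obtain s where s: "s \<in> L" "t \<in> split_at z {s}"
      using t(1) unfolding split_at_iff by blast
    obtain s' where s': "s' \<in> L" "t' \<in> split_at z {s'}"
      using t(2) unfolding split_at_iff by blast
    have sub: "pts t \<subseteq> pts s" "pts t' \<subseteq> pts s'"
      using ax[OF s(1)] ax[OF s'(1)] s(2) s'(2) by (simp_all add: split_at_subset)
    show ?thesis
    proof (cases "s = s'")
      case False
      then have "pts s \<inter> pts s' \<subseteq> P" using pl s(1) s'(1) by (simp add: planar_def)
      then show ?thesis using sub by blast
    next
      case True
      have "z \<in> inner s" using s(2) s'(2) t(3) True unfolding split_at_iff by blast
      moreover obtain u u' where u: "s = {u, u'}" using ax[OF s(1)] by (cases rule: axis_cases) auto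
      ultimately have "split_at z {s} = {{u, z}, {u', z}}" using split_at_inside[of z u u'] by simp
      then have "t \<in> {{u, z}, {u', z}}" "t' \<in> {{u, z}, {u', z}}"
        using s(2) s'(2) True by simp_all
      then have "pts t \<inter> pts t' = pts {u, z} \<inter> pts {u', z}"
        using t(3) by (elim insertE emptyE) (simp_all add: Int_commute)
      then show ?thesis
        using cut_segment(2)[of u u' z] ax[OF s(1)] \<open>z \<in> inner s\<close> u by auto
    qed
  qed
  show ?thesis using 1 2 3 by (auto simp: planar_def)
qed

section \<open>Unit edges\<close>

text \<open>Meant for neighbouring grid points \<open>p\<close> and \<open>q\<close>, where it says
  that the unit edge between them is covered.\<close>

definition edge :: "segment set \<Rightarrow> point \<Rightarrow> point \<Rightarrow> bool" where
  "edge L p q \<longleftrightarrow> (\<exists>s\<in>L. p \<in> pts s \<and> q \<in> pts s)"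

lemma edge_insert: "edge (insert s L) p q \<longleftrightarrow> p \<in> pts s \<and> q \<in> pts s \<or> edge L p q"
  by (auto simp: edge_def)

lemma inner_horizontal: "a < b \<Longrightarrow> z \<in> inner {(a, y), (b, y)} \<longleftrightarrow> (\<exists>e. z = (e, y) \<and> a < e \<and> e < b)"
  unfolding inner_def by (cases z) (auto simp: pts_horizontal)

lemma inner_vertical: "a < b \<Longrightarrow> z \<in> inner {(x, a), (x, b)} \<longleftrightarrow> (\<exists>e. z = (x, e) \<and> a < e \<and> e < b)"
  unfolding inner_def by (cases z) (auto simp: pts_vertical)

lemma split_at_keep: "s \<in> L \<Longrightarrow> z \<notin> inner s \<Longrightarrow> s \<in> split_at z L"
  by (simp add: split_at_iff)

lemma split_at_cut: "s \<in> L \<Longrightarrow> z \<in> inner s \<Longrightarrow> u \<in> s \<Longrightarrow> {u, z} \<in> split_at z L"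
  unfolding split_at_iff by blast

text \<open>The point \<open>z\<close> is a grid point and so cannot separate two neighbouring grid
  points: one of the pieces still contains both.\<close>

lemma edge_split:
  assumes "\<forall>s\<in>L. axis s" and adj: "q = (Suc (fst p), snd p) \<or> q = (fst p, Suc (snd p))"
  shows "edge (split_at z L) p q \<longleftrightarrow> edge L p q"
proof
  assume "edge (split_at z L) p q"
  then obtain t where t: "t \<in> split_at z L" "p \<in> pts t" "q \<in> pts t" by (auto simp: edge_def)
  from t(1) assms(1) obtain s where "s \<in> L" "pts t \<subseteq> pts s" by (rule split_at_source)
  then show "edge L p q" using t unfolding edge_def by blast
next
  assume "edge L p q"
  then obtain s where s: "s \<in> L" "p \<in> pts s" "q \<in> pts s" by (auto simp: edge_def)
  show "edge (split_at z L) p q"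
  proof (cases "z \<in> inner s")
    case False
    then show ?thesis using s split_at_keep unfolding edge_def by blast
  next
    case True
    then have piece: "{u, z} \<in> split_at z L" if "u \<in> s" for u
      using that s(1) split_at_cut by blast
    have "axis s" using assms(1) s(1) by (rule bspec)
    then show ?thesis
    proof (cases rule: axis_cases)
      case (horizontal a b y)
      then obtain e where e: "z = (e, y)" "a < e" "e < b"
        using True inner_horizontal[of a b z y] by auto
      have "pts {(a, y), z} = {a..e} \<times> {y}" "pts {(b, y), z} = {e..b} \<times> {y}"
        using e pts_horizontal[of a e y] pts_horizontal[of e b y] by (simp_all add: insert_commute)
      then have "p \<in> pts {(a, y), z} \<and> q \<in> pts {(a, y), z} \<or> p \<in> pts {(b, y), z} \<and> q \<in> pts {(b, y), z}"
        using adj s(2,3) unfolding horizontal(5) by (cases p; elim disjE) (auto simp del: insert_iff)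
      moreover have "{(a, y), z} \<in> split_at z L" "{(b, y), z} \<in> split_at z L"
        using piece horizontal(2) by simp_all
      ultimately show ?thesis unfolding edge_def by metis
    next
      case (vertical x a b)
      then obtain e where e: "z = (x, e)" "a < e" "e < b"
        using True inner_vertical[of a b z x] by auto
      have "pts {(x, a), z} = {x} \<times> {a..e}" "pts {(x, b), z} = {x} \<times> {e..b}"
        using e pts_vertical[of a e x] pts_vertical[of e b x] by (simp_all add: insert_commute)
      then have "p \<in> pts {(x, a), z} \<and> q \<in> pts {(x, a), z} \<or> p \<in> pts {(x, b), z} \<and> q \<in> pts {(x, b), z}"
        using adj s(2,3) unfolding vertical(5) by (cases p; elim disjE) (auto simp del: insert_iff)
      moreover have "{(x, a), z} \<in> split_at z L" "{(x, b), z} \<in> split_at z L"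
        using piece vertical(2) by simp_all
      ultimately show ?thesis unfolding edge_def by metis
    qed
  qed
qed

text \<open>Locally, condition (iii) says that a straight line passes through the point. Successors
  are used so that the neighbours to the left and below can be named.\<close>

lemma good_iff_edges:
  assumes pl: "planar n P L" and p: "(Suc k, Suc y) \<in> P"
  shows "good L (Suc k, Suc y) \<longleftrightarrow>
    edge L (k, Suc y) (Suc k, Suc y) \<and> edge L (Suc k, Suc y) (Suc (Suc k), Suc y) \<or>
    edge L (Suc k, y) (Suc k, Suc y) \<and> edge L (Suc k, Suc y) (Suc k, Suc (Suc y))"
    (is "_ \<longleftrightarrow> ?H \<or> ?V")
proof -
  have horiz: "horizontal s" if "s \<in> L" "(c, r) \<in> pts s" "(Suc c, r) \<in> pts s" for s c r
    using planar_axis[OF pl that(1)] that(2,3) by (cases rule: axis_cases) auto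
  have vert: "vertical s" if "s \<in> L" "(c, r) \<in> pts s" "(c, Suc r) \<in> pts s" for s c r
    using planar_axis[OF pl that(1)] that(2,3) by (cases rule: axis_cases) auto
  have 1: "good L (Suc k, Suc y)" if ?H
  proof -
    from that obtain s t where st: "s \<in> L" "(k, Suc y) \<in> pts s" "(Suc k, Suc y) \<in> pts s"
      "t \<in> L" "(Suc k, Suc y) \<in> pts t" "(Suc (Suc k), Suc y) \<in> pts t" unfolding edge_def by blast
    have o: "horizontal s" "horizontal t" using horiz st by blast+
    \<comment> \<open>A single segment covering both edges would have the point, which lies in
      \<open>P\<close>, in its interior.\<close>
    have "s \<noteq> t"
    proof
      assume "s = t"
      from o obtain a b r where "a < b" "s = {(a, r), (b, r)}" unfolding horizontal_def by blast
      then show False using st \<open>s = t\<close> planar_endpoint[OF pl st(1) p] by (auto simp: pts_horizontal)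
    qed
    then show "good L (Suc k, Suc y)" using st o unfolding good_def same_orientation_def by blast
  qed
  have 2: "good L (Suc k, Suc y)" if ?V
  proof -
    from that obtain s t where st: "s \<in> L" "(Suc k, y) \<in> pts s" "(Suc k, Suc y) \<in> pts s"
      "t \<in> L" "(Suc k, Suc y) \<in> pts t" "(Suc k, Suc (Suc y)) \<in> pts t" unfolding edge_def by blast
    have o: "vertical s" "vertical t" using vert st by blast+
    have "s \<noteq> t"
    proof
      assume "s = t"
      from o obtain a b r where "a < b" "s = {(r, a), (r, b)}" unfolding vertical_def by blast
      then show False using st \<open>s = t\<close> planar_endpoint[OF pl st(1) p] by (auto simp: pts_vertical)
    qed
    then show "good L (Suc k, Suc y)" using st o unfolding good_def same_orientation_def by blast
  qed
  have 3: "?H \<or> ?V" if "good L (Suc k, Suc y)"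
  proof -
    from that obtain s t where st: "s \<in> L" "t \<in> L" "s \<noteq> t" "(Suc k, Suc y) \<in> pts s" "(Suc k, Suc y) \<in> pts t"
    "same_orientation s t" unfolding good_def by blast
  have ep: "(Suc k, Suc y) \<in> s" "(Suc k, Suc y) \<in> t" using planar_endpoint[OF pl _ p] st by blast+
  have meet: "q \<in> s \<inter> t" if "q \<in> pts s" "q \<in> pts t" for q using planar_meet[OF pl st(1-3) that] .
  show ?thesis
  proof (cases "horizontal s")
    case True
    with st(6) have "horizontal t" using orientation_exclusive unfolding same_orientation_def by blast
    then obtain a b where t: "a < b" "t = {(a, Suc y), (b, Suc y)}" "pts t = {a..b} \<times> {Suc y}"
      using ep(2) unfolding horizontal_def by (auto simp: pts_horizontal)
    from True obtain c d where s: "c < d" "s = {(c, Suc y), (d, Suc y)}" "pts s = {c..d} \<times> {Suc y}"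
      using ep(1) unfolding horizontal_def by (auto simp: pts_horizontal)
    \<comment> \<open>Two distinct collinear segments ending at the point leave it in opposite
      directions; otherwise the far end of the shorter one would lie inside the longer one.\<close>
    have "b = Suc k \<and> c = Suc k \<or> d = Suc k \<and> a = Suc k"
    proof (rule ccontr)
      assume *: "\<not> ?thesis"
      have "a = Suc k \<and> c = Suc k \<or> b = Suc k \<and> d = Suc k" using * ep s t by auto
      then show False
      proof
        assume *: "a = Suc k \<and> c = Suc k"
        then have "b < d \<or> d < b" using s(2) t(2) st(3) by (metis nat_neq_iff)
        then show False
          using meet[of "(b, Suc y)"] meet[of "(d, Suc y)"] s t * by (elim disjE) simp_all
      next
        assume *: "b = Suc k \<and> d = Suc k"
        then have "a < c \<or> c < a" using s(2) t(2) st(3) by (metis nat_neq_iff)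
        then show False
          using meet[of "(a, Suc y)"] meet[of "(c, Suc y)"] s t * by (elim disjE) simp_all
      qed
    qed
    then have ?H
    proof
      assume "b = Suc k \<and> c = Suc k"
      then have "(k, Suc y) \<in> pts t" "(Suc k, Suc y) \<in> pts t" "(Suc k, Suc y) \<in> pts s" "(Suc (Suc k), Suc y) \<in> pts s"
        using s t by auto
      then show ?H unfolding edge_def using st(1,2) by blast
    next
      assume "d = Suc k \<and> a = Suc k"
      then have "(k, Suc y) \<in> pts s" "(Suc k, Suc y) \<in> pts s" "(Suc k, Suc y) \<in> pts t" "(Suc (Suc k), Suc y) \<in> pts t"
        using s t by auto
      then show ?H unfolding edge_def using st(1,2) by blast
    qed
    then show ?thesis ..
  next
    case False
    with st(6) have "vertical s" "vertical t" unfolding same_orientation_def by blast+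
    from this(2) obtain a b where t: "a < b" "t = {(Suc k, a), (Suc k, b)}" "pts t = {Suc k} \<times> {a..b}"
      using ep(2) unfolding vertical_def by (auto simp: pts_vertical)
    from \<open>vertical s\<close> obtain c d where s: "c < d" "s = {(Suc k, c), (Suc k, d)}" "pts s = {Suc k} \<times> {c..d}"
      using ep(1) unfolding vertical_def by (auto simp: pts_vertical)
    have "b = Suc y \<and> c = Suc y \<or> d = Suc y \<and> a = Suc y"
    proof (rule ccontr)
      assume *: "\<not> ?thesis"
      have "a = Suc y \<and> c = Suc y \<or> b = Suc y \<and> d = Suc y" using * ep s t by auto
      then show False
      proof
        assume *: "a = Suc y \<and> c = Suc y"
        then have "b < d \<or> d < b" using s(2) t(2) st(3) by (metis nat_neq_iff)
        then show False
          using meet[of "(Suc k, b)"] meet[of "(Suc k, d)"] s t * by (elim disjE) simp_all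
      next
        assume *: "b = Suc y \<and> d = Suc y"
        then have "a < c \<or> c < a" using s(2) t(2) st(3) by (metis nat_neq_iff)
        then show False
          using meet[of "(Suc k, a)"] meet[of "(Suc k, c)"] s t * by (elim disjE) simp_all
      qed
    qed
    then have ?V
    proof
      assume "b = Suc y \<and> c = Suc y"
      then have "(Suc k, y) \<in> pts t" "(Suc k, Suc y) \<in> pts t" "(Suc k, Suc y) \<in> pts s" "(Suc k, Suc (Suc y)) \<in> pts s"
        using s t by auto
      then show ?V unfolding edge_def using st(1,2) by blast
    next
      assume "d = Suc y \<and> a = Suc y"
      then have "(Suc k, y) \<in> pts s" "(Suc k, Suc y) \<in> pts s" "(Suc k, Suc y) \<in> pts t" "(Suc k, Suc (Suc y)) \<in> pts t"
        using s t by auto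
      then show ?V unfolding edge_def using st(1,2) by blast
    qed
    then show ?thesis ..
  qed
qed
  from 1 2 3 show ?thesis by blast
qed

text \<open>A new point of the grid interior has to lie inside an existing segment, which then
  continues on both sides of it.\<close>

definition anchored :: "nat \<Rightarrow> point set \<Rightarrow> segment set \<Rightarrow> point \<Rightarrow> bool" where
  "anchored n P L z \<longleftrightarrow> z \<in> P \<or> z \<notin> {1..n} \<times> {1..n} \<or> (\<exists>s\<in>L. z \<in> inner s)"

lemma good_split_inner:
  assumes "s \<in> L" "z \<in> inner s" "axis s"
  shows "good (split_at z L) z"
proof -
  obtain u u' where u: "s = {u, u'}" "u \<noteq> u'"
    using assms(3) by (cases rule: axis_cases) auto
  have p: "{u, z} \<in> split_at z L" "{u', z} \<in> split_at z L"
    using assms(1,2) u(1) split_at_cut by blast+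
  have "z \<notin> s" using assms(2) by (simp add: inner_def)
  then have ne: "{u, z} \<noteq> {u', z}" using u by (simp add: doubleton_eq_iff)
  have eq: "{u', u} = s" using u(1) by blast
  have z: "z \<in> inner {u, u'}" "axis {u, u'}" "z \<in> inner {u', u}" "axis {u', u}"
    using assms(2,3) unfolding eq u(1)[symmetric] by simp_all
  have "same_orientation {u, z} {u', z}"
    unfolding same_orientation_def cut_segment(3,4)[OF z(2,1)] cut_segment(3,4)[OF z(4,3)] eq u(1)[symmetric]
    using assms(3) by simp
  moreover have "z \<in> pts {u, z}" "z \<in> pts {u', z}" using cut_segment(2)[OF z(2,1)] by blast+
  ultimately show ?thesis using p ne unfolding good_def by metis
qed

text \<open>Old points keep their unit edges because cutting changes none; a new interior point lies
  between the two pieces of the segment that anchors it.\<close>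

lemma valid_split:
  assumes v: "valid n (P, L)" and z: "z \<in> grid n - corners n" and anch: "anchored n P L z"
    and p: "p \<in> insert z P" "p \<in> {1..n} \<times> {1..n}"
  shows "good (split_at z L) p"
proof (cases "p \<in> P")
  case True
  have pl: "planar n P L" and g: "good L p" using v p True by (auto simp: valid_iff)
  have ax: "\<forall>s\<in>L. axis s" using planar_axis[OF pl] by blast
  have "p = (Suc (fst p - 1), Suc (snd p - 1))" using p(2) by (cases p) auto
  then obtain k y where ky: "p = (Suc k, Suc y)" by blast
  show ?thesis
    using g True pl planar_split[OF pl z] unfolding ky
    by (subst good_iff_edges[of n "insert z P"]) (simp_all add: good_iff_edges edge_split[OF ax])
next
  case False
  then obtain s where "s \<in> L" "z \<in> inner s" "p = z"
    using anch p unfolding anchored_def by blast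
  then show ?thesis
    using good_split_inner planar_axis v unfolding valid_iff by blast
qed

section \<open>Cutting at two points in either order\<close>

lemma split_at_inside2:
  assumes ax: "axis {a, b}" and v: "v \<in> inner {a, b}" and w: "w \<in> inner {a, v}"
  shows "split_at w (split_at v {{a, b}}) = {{a, w}, {w, v}, {v, b}}"
    "split_at v (split_at w {{a, b}}) = {{a, w}, {w, v}, {v, b}}"
proof -
  note cv = cut_segment[OF ax v]
  have axv: "axis {a, v}" using cv(3,4) ax by simp
  note cw = cut_segment[OF axv w]
  have ba: "axis {b, a}" "v \<in> inner {b, a}" using ax v by (simp_all add: insert_commute)
  note cb = cut_segment[OF ba]
  have ends: "a \<in> pts {a, v}" "v \<in> pts {a, v}" "b \<in> pts {b, v}" "v \<in> pts {v, w}"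
    using axis_endpoints[of "{a, v}"] axis_endpoints[of "{b, v}"] axis_endpoints[of "{v, w}"]
      cut_segment(3,4)[of v a w] axv w cb(3,4) ba(1) by (auto simp: insert_commute)
  have "w \<in> pts {a, v}" "w \<noteq> a" "w \<noteq> v" using w by (auto simp: inner_def)
  have "w \<notin> pts {b, v}" using cv(2) \<open>w \<in> pts {a, v}\<close> \<open>w \<noteq> v\<close> by blast
  have "b \<noteq> v" using v by (auto simp: inner_def)
  then have "b \<notin> pts {a, v}" using ends cv(2) by blast
  then have wab: "w \<in> inner {a, b}"
    using cv(1) \<open>w \<in> pts {a, v}\<close> \<open>w \<noteq> a\<close> by (auto simp: inner_def)
  note cwab = cut_segment[OF ax wab]
  have "v \<notin> pts {a, w}" using cw(2) ends(4) \<open>w \<noteq> v\<close> by (metis IntI singletonD)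
  then have vbw: "v \<in> inner {b, w}"
    using cwab(1) v \<open>w \<noteq> v\<close> by (auto simp: inner_def)
  have "w \<notin> inner {b, v}" "v \<notin> inner {a, w}"
    using \<open>w \<notin> pts {b, v}\<close> \<open>v \<notin> pts {a, w}\<close> by (simp_all add: inner_def)
  then show "split_at w (split_at v {{a, b}}) = {{a, w}, {w, v}, {v, b}}"
    "split_at v (split_at w {{a, b}}) = {{a, w}, {w, v}, {v, b}}"
    using split_at_inside[OF v] split_at_inside[OF w] split_at_inside[OF wab] split_at_inside[OF vbw]
      split_at_outside[of w "{b, v}"] split_at_outside[of v "{a, w}"]
    by (simp_all add: split_at_insert[of _ _ "{_}"] insert_commute)
qed

lemma split_at_inside_outside:
  assumes ax: "axis s" and w: "w \<in> inner s" and v: "v \<notin> inner s"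
  shows "split_at v (split_at w {s}) = split_at w {s}"
proof (rule split_at_id)
  fix t assume t: "t \<in> split_at w {s}"
  have ax1: "\<forall>s'\<in>{s}. axis s'" using ax by simp
  show "v \<notin> inner t"
    using t ax1
  proof (cases rule: split_at_piece)
    case 1
    then show ?thesis using w by simp
  next
    case (2 u u')
    then have s: "s = {u, u'}" by simp
    note cut = cut_segment[OF ax[unfolded s] w[unfolded s]]
    have "axis {u', u}" "w \<in> inner {u', u}" using ax w s by (simp_all add: insert_commute)
    from cut_segment(3,4)[OF this] this(1) have "u' \<in> pts {u', w}"
      using axis_endpoints[of "{u', w}"] by blast
    moreover have "u' \<noteq> w" using w s by (auto simp: inner_def)
    ultimately have "u' \<notin> pts {u, w}" using cut(2) by blast
    then have "inner {u, w} \<subseteq> inner s" using cut(1) s by (auto simp: inner_def)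
    then show ?thesis using v 2(3) by blast
  qed
qed

lemma split_at_commute_segment:
  assumes ax: "axis s"
  shows "split_at v (split_at w {s}) = split_at w (split_at v {s})"
proof (cases "v \<in> inner s \<and> w \<in> inner s \<and> v \<noteq> w")
  case False
  then show ?thesis
    using split_at_inside_outside[OF ax, of v w] split_at_inside_outside[OF ax, of w v]
      split_at_outside[of v s] split_at_outside[of w s] by metis
next
  case True
  obtain a b where s: "s = {a, b}" using ax by (cases rule: axis_cases) auto
  then have s': "s = {b, a}" by blast
  have "w \<in> pts {a, v} \<union> pts {b, v}"
    using True s cut_segment(1)[of a b v] ax by (simp add: inner_def)
  then have "w \<in> inner {a, v} \<or> w \<in> inner {b, v}" using True s by (auto simp: inner_def)
  then show ?thesis
  proof
    assume "w \<in> inner {a, v}"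
    then show ?thesis using split_at_inside2[of a b v w] True ax unfolding s by metis
  next
    assume "w \<in> inner {b, v}"
    then show ?thesis using split_at_inside2[of b a v w] True ax unfolding s' by metis
  qed
qed

text \<open>Cutting acts on each segment separately, so the case of one segment suffices. This
  allows the roles of \<open>v\<close> and \<open>w\<close> in an A-flip to be exchanged.\<close>

lemma split_at_commute:
  assumes "\<forall>s\<in>L. axis s"
  shows "split_at v (split_at w L) = split_at w (split_at v L)"
proof -
  have U: "split_at z M = (\<Union>s\<in>M. split_at z {s})" for z M
    unfolding split_at_def by blast
  have "split_at z (\<Union>s\<in>L. f s) = (\<Union>s\<in>L. split_at z (f s))" for z and f :: "segment \<Rightarrow> segment set"
    unfolding split_at_def by blast
  then have "split_at z (split_at z' L) = (\<Union>s\<in>L. split_at z (split_at z' {s}))" for z z'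
    using U[of z' L] by metis
  with assms show ?thesis using split_at_commute_segment by simp
qed

lemma planar_cross: "planar n P L \<Longrightarrow> s \<in> L \<Longrightarrow> t \<in> L \<Longrightarrow> s \<noteq> t \<Longrightarrow> pts s \<inter> pts t \<subseteq> P"
  by (simp add: planar_def)

section \<open>Simulation by flips\<close>

text \<open>All flips of the simulation start at an existing point \<open>a\<close>. Cutting at
  \<open>a\<close> then has no effect, and the two cuts of the definition reduce to the one at
  \<open>b\<close>.\<close>

lemma flip_stepI:
  assumes "valid n (P, L)" "a \<in> P" "axis {a, b}"
    and "valid n (insert b P, insert {a, b} (split_at b L))"
    and "L' \<subseteq> insert {a, b} (split_at b L)" "valid n (insert b P, L')"
  shows "flip_step n (P, L) (insert b P, L')"
proof -
  have "split_at a (insert {a, b} L) = insert {a, b} L"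
  proof (rule split_at_id)
    fix s assume "s \<in> insert {a, b} L"
    then show "a \<notin> inner s"
      using assms(1,2) planar_not_inner endpoint_not_inner unfolding valid_iff by blast
  qed
  moreover have "split_at b (insert {a, b} L) = insert {a, b} (split_at b L)"
    using endpoint_not_inner[of b "{a, b}"] by (simp add: split_at_insert[of b _ L] split_at_outside)
  ultimately have eq: "split_at b (split_at a (L \<union> {{a, b}})) = insert {a, b} (split_at b L)" by simp
  have eqP: "P \<union> {a, b} = insert b P" using assms(2) by blast
  show ?thesis unfolding flip_step_def prod.case
    by (intro conjI exI[of _ a] exI[of _ b] exI[of _ "insert {a, b} (split_at b L)"])
      (use assms eq eqP in simp_all)
qed

lemma valid_insert:
  assumes "valid n (P, L)" "planar n P (insert s L)"
  shows "valid n (P, insert s L)"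
  using assms good_mono[of L _ "insert s L"] unfolding valid_iff by (meson subset_insertI)

text \<open>Directly after the flip of \<open>[x,z]\<close> the state is the target together with
  \<open>[x,y]\<close>. By perpendicularity \<open>z\<close> is not on \<open>[x,y]\<close>, so this
  segment is not cut and meets the new one only in \<open>x\<close>; validity is then inherited from
  the target.\<close>

lemma A_rotate_flip:
  assumes "A_rotate n R R'"
  shows "flip_step n R R'"
proof -
  obtain P L P' L' where R: "R = (P, L)" "R' = (P', L')" by (cases R, cases R') auto
  obtain x y z where v: "valid n (P, L)" and xy: "{x, y} \<in> L"
    and o: "other_orientation {x, y} {x, z}" and P': "P' = insert z P"
    and L': "L' = split_at z ((L - {{x, y}}) \<union> {{x, z}})" and v': "valid n (P', L')"
    using assms unfolding A_rotate_def R by auto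
  have pl: "planar n P L" and pl': "planar n P' L'" using v v' by (simp_all add: valid_iff)
  have ax: "\<forall>s\<in>L. axis s" using planar_axis[OF pl] by blast
  have axxz: "axis {x, z}" using o by (auto simp: other_orientation_def)
  have z: "z \<notin> pts {x, y}"
  proof
    assume "z \<in> pts {x, y}"
    moreover have "z \<in> pts {x, z}" using axis_endpoints[OF axxz] by simp
    ultimately have "z \<in> {x}" using perpendicular_meet[OF o] by (metis IntI)
    then show False using axis_distinct[OF axxz] by simp
  qed
  define M where "M = split_at z (L - {{x, y}})"
  have L'': "L' = insert {x, z} M"
    unfolding L' M_def split_at_Un using split_at_outside[of z "{x, z}"] endpoint_not_inner[of z "{x, z}"] by simp
  have "L = insert {x, y} (L - {{x, y}})" using xy by (simp add: insert_absorb)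
  then have "split_at z L = insert {x, y} M"
    unfolding M_def using split_at_insert[of z "{x, y}" "L - {{x, y}}"]
      split_at_outside[of z "{x, y}"] z inner_subset by (metis insert_is_Un subsetD)
  then have eq: "insert {x, z} (split_at z L) = insert {x, y} L'" unfolding L'' by (simp add: insert_commute)
  have pl2: "planar n P' (insert {x, y} L')"
  proof (rule planar_insert[OF pl'])
    show "axis {x, y}" using ax xy by blast
    have "pts {x, y} \<inter> P = {x, y}" using pl xy by (simp add: planar_def)
    then show "pts {x, y} \<inter> P' = {x, y}" unfolding P' using z by blast
    fix t assume t: "t \<in> L'" "t \<noteq> {x, y}"
    show "pts {x, y} \<inter> pts t \<subseteq> P'"
    proof (cases "t = {x, z}")
      case True
      then show ?thesis using perpendicular_meet[OF o] planar_subset[OF pl xy] P' by blast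
    next
      case False
      then have "t \<in> M" using t L'' by blast
      then have tM: "t \<in> split_at z (L - {{x, y}})" unfolding M_def .
      have "\<forall>s\<in>L - {{x, y}}. axis s" using ax by blast
      with tM obtain s where s: "s \<in> L - {{x, y}}" "pts t \<subseteq> pts s" by (rule split_at_source)
      then have "pts {x, y} \<inter> pts s \<subseteq> P" using planar_cross[OF pl xy, of s] by fast
      moreover have "pts {x, y} \<inter> pts t \<subseteq> pts {x, y} \<inter> pts s"
        using s(2) by (rule Int_mono[OF subset_refl])
      ultimately show ?thesis unfolding P' by (meson subset_insertI subset_trans)
    qed
  qed
  have "valid n (P', insert {x, y} L')"
    using v' pl2 by (rule valid_insert)
  then have "flip_step n (P, L) (insert z P, L')"
    using flip_stepI[of n P L x z L'] v v' axxz planar_subset[OF pl xy] eq P' by auto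
  then show ?thesis using R P' by simp
qed


lemma unanchored_outside:
  assumes pl: "planar n P L" and z: "\<not> anchored n P L z" and s: "s \<in> L"
  shows "z \<notin> pts s"
proof
  assume "z \<in> pts s"
  moreover have "z \<notin> s" using z planar_subset[OF pl s] unfolding anchored_def by blast
  ultimately have "z \<in> inner s" by (simp add: inner_def)
  then show False using z s unfolding anchored_def by blast
qed

text \<open>The hypothesis \<open>anch\<close> secures condition (iii) at \<open>b\<close>, while
  \<open>ends\<close> and \<open>cross\<close> secure (i) and (ii) for the new segment.\<close>

lemma first_flip:
  assumes v: "valid n (P, L)" and a: "a \<in> P" "axis {a, b}" and anch: "anchored n P L b"
    and b: "b \<in> grid n - corners n"
    and ends: "pts {a, b} \<inter> insert b P = {a, b}"
    and cross: "\<And>t. t \<in> split_at b L \<Longrightarrow> t \<noteq> {a, b} \<Longrightarrow> pts {a, b} \<inter> pts t \<subseteq> insert b P"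
  shows "valid n (insert b P, insert {a, b} (split_at b L))"
    "flip_step n (P, L) (insert b P, insert {a, b} (split_at b L))"
proof -
  have pl: "planar n (insert b P) (insert {a, b} (split_at b L))"
    using v b a(2) ends cross by (intro planar_insert planar_split) (simp_all add: valid_iff)
  have "good (insert {a, b} (split_at b L)) p" if "p \<in> insert b P \<inter> ({1..n} \<times> {1..n})" for p
    using valid_split[OF v b anch, of p] that by (auto intro: good_mono)
  with pl show "valid n (insert b P, insert {a, b} (split_at b L))" unfolding valid_iff by simp
  then show "flip_step n (P, L) (insert b P, insert {a, b} (split_at b L))"
    using flip_stepI[OF v a _ subset_refl] by simp
qed

text \<open>The hypothesis that \<open>w\<close> is not inside \<open>[y,v]\<close> is no loss of generality; \<open>v\<close> may lie
  inside \<open>[y,w]\<close>. If then \<open>v\<close> lies in the interior of a face, only the flip of \<open>[y,w]\<close> can come first.\<close>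

lemma two_flips_aux:
  assumes v: "valid n (P, L)" and y: "y \<in> P" and ax: "axis {y, v}" "axis {y, w}" and vw: "v \<noteq> w"
    and w: "w \<notin> inner {y, v}"
    and L2: "L2 = split_at w (split_at v (insert {y, v} (insert {y, w} L)))"
    and v2: "valid n (insert v (insert w P), L2)"
    and sub: "L' \<subseteq> L2" and v': "valid n (insert v (insert w P), L')"
  shows "\<exists>R. flip_step n (P, L) R \<and> flip_step n R (insert v (insert w P), L')"
proof -
  let ?P = "insert v (insert w P)"
  have pl: "planar n P L" and pl2: "planar n ?P L2" using v v2 by (simp_all add: valid_iff)
  have axL: "\<forall>s\<in>L. axis s" using planar_axis[OF pl] by blast
  have grid: "v \<in> grid n - corners n" "w \<in> grid n - corners n"
    using pl2 by (auto simp: planar_def is_state_def)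
  have "y \<noteq> v" "y \<noteq> w" using ax axis_distinct by blast+
  have wv: "w \<notin> pts {y, v}" using w \<open>y \<noteq> w\<close> vw by (auto simp: inner_def)
  let ?D = "split_at w (split_at v L)"
  have yv: "split_at v {{y, v}} = {{y, v}}" "split_at w {{y, v}} = {{y, v}}"
    using w endpoint_not_inner[of v "{y, v}"] by (simp_all add: split_at_outside)
  have L2': "L2 = insert {y, v} (?D \<union> split_at w (split_at v {{y, w}}))"
  proof -
    have "insert {y, v} (insert {y, w} L) = {{y, v}} \<union> ({{y, w}} \<union> L)"
      unfolding Un_insert_left Un_empty_left ..
    then have "L2 = {{y, v}} \<union> (split_at w (split_at v {{y, w}}) \<union> ?D)"
      unfolding L2 by (simp only: split_at_Un yv)
    then show ?thesis
      using Un_commute[of "split_at w (split_at v {{y, w}})" ?D] by simp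
  qed
  have inD: "t \<in> L2" if "t \<in> ?D" for t using that L2' by simp
  have D_sub: "\<exists>s\<in>L. pts t \<subseteq> pts s" if "t \<in> ?D" for t
  proof -
    have "\<forall>s\<in>split_at v L. axis s" using split_at_source[OF _ axL] by blast
    with that obtain s where s: "s \<in> split_at v L" "pts t \<subseteq> pts s" by (rule split_at_source)
    from s(1) axL obtain s' where "s' \<in> L" "pts s \<subseteq> pts s'" by (rule split_at_source)
    with s show ?thesis by blast
  qed
  have yw_in: "split_at v {{y, w}} = {{y, v}, {w, v}}" "split_at w (split_at v {{y, w}}) = {{y, v}, {w, v}}"
    "pts {y, w} = pts {y, v} \<union> pts {w, v}" "axis {w, v}"
    if "v \<in> inner {y, w}"
  proof -
    show 1: "split_at v {{y, w}} = {{y, v}, {w, v}}" using that by (rule split_at_inside)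
    show "split_at w (split_at v {{y, w}}) = {{y, v}, {w, v}}"
      unfolding 1 using yv(2) endpoint_not_inner[of w "{w, v}"]
      by (simp add: split_at_insert[of _ _ "{_}"] split_at_outside insert_commute)
    show "pts {y, w} = pts {y, v} \<union> pts {w, v}" using cut_segment(1)[OF ax(2) that] by simp
    have "axis {w, y}" "v \<in> inner {w, y}" using ax(2) that by (simp_all add: insert_commute)
    from cut_segment(3,4)[OF this] this(1) show "axis {w, v}" by simp
  qed
  have good2: "good L2 p" if "p \<in> ?P" "p \<in> {1..n} \<times> {1..n}" for p
    using v2 that unfolding valid_iff by blast
  show ?thesis
  proof (cases "anchored n P L v")
    case True
    let ?P1 = "insert v P" and ?L1 = "insert {y, v} (split_at v L)"
    have "pts {y, v} \<inter> ?P = {y, v}" using pl2 L2' by (simp add: planar_def)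
    then have ends: "pts {y, v} \<inter> ?P1 = {y, v}" using wv y by auto
    \<comment> \<open>The target may contain \<open>t\<close> only cut at \<open>w\<close>. The
      piece \<open>t'\<close> of \<open>t\<close> through the common point equals \<open>t\<close>
      or ends at \<open>w\<close>, hence is not \<open>[y,v]\<close>, and planarity of
      \<open>L2\<close> applies to it.\<close>
    have cross: "pts {y, v} \<inter> pts t \<subseteq> ?P1" if t: "t \<in> split_at v L" "t \<noteq> {y, v}" for t
    proof
      fix p assume p: "p \<in> pts {y, v} \<inter> pts t"
      have "axis t" using split_at_source[OF t(1) axL] by blast
      with t(1) p obtain t' where t': "t' \<in> ?D" "p \<in> pts t'" "t' = t \<or> w \<in> t'"
        using split_at_cover by blast
      have "t' \<noteq> {y, v}" using t' t \<open>y \<noteq> w\<close> vw by blast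
      moreover have "{y, v} \<in> L2" using L2' by simp
      ultimately have "p \<in> {y, v} \<inter> t'"
        using planar_meet[OF pl2, of "{y, v}" t' p] p t'(2) inD[OF t'(1)] by simp
      then show "p \<in> ?P1" using y by blast
    qed
    note flip = first_flip[OF v y ax(1) True grid(1) ends cross]
    have split1: "split_at w ?L1 = insert {y, v} ?D"
      using split_at_insert[of w "{y, v}" "split_at v L"] yv by simp
    have "flip_step n (?P1, ?L1) (insert w ?P1, L')"
    proof (cases "v \<in> inner {y, w}")
      case False
      have "split_at w (split_at v {{y, w}}) = {{y, w}}"
        using False endpoint_not_inner[of w "{y, w}"] by (simp add: split_at_outside)
      then have "insert {y, w} (split_at w ?L1) = L2" unfolding split1 L2' by blast
      then show ?thesis
        using flip(1) y ax(2) v2 sub v' by (intro flip_stepI[of _ _ _ y]) (simp_all add: insert_commute)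
    next
      \<comment> \<open>Since \<open>[y,v]\<close> is already present, the missing part of
        \<open>[y,w]\<close> is \<open>[v,w]\<close>, and this is what the second flip
        draws.\<close>
      case inn: True
      have "insert {v, w} (split_at w ?L1) = L2"
        unfolding split1 L2' yw_in(2)[OF inn] by (auto simp: insert_commute)
      then show ?thesis
        using flip(1) yw_in(4)[OF inn] v2 sub v'
        by (intro flip_stepI[of _ _ _ v]) (simp_all add: insert_commute)
    qed
    then show ?thesis using flip(2) by (metis insert_commute)
  next
    case False
    note v_out = unanchored_outside[OF pl False]
    have vP: "v \<notin> P" "v \<in> {1..n} \<times> {1..n}" using False by (auto simp: anchored_def)
    have v_D: "v \<notin> pts t" if "t \<in> ?D" for t using D_sub[OF that] v_out by blast
    \<comment> \<open>No old segment contains \<open>v\<close>. If \<open>[y,w]\<close> did not pass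
      through it either, \<open>[y,v]\<close> would be the only segment of \<open>L2\<close> at
      \<open>v\<close>, against condition (iii).\<close>
    have inn: "v \<in> inner {y, w}"
    proof (rule ccontr)
      assume n: "v \<notin> inner {y, w}"
      then have "v \<notin> pts {y, w}" using \<open>y \<noteq> v\<close> vw by (auto simp: inner_def)
      moreover have "split_at w (split_at v {{y, w}}) = {{y, w}}"
        using n endpoint_not_inner[of w "{y, w}"] by (simp add: split_at_outside)
      ultimately have "t = {y, v}" if "t \<in> L2" "v \<in> pts t" for t
        using that v_D unfolding L2' by auto
      then show False using good2[of v] vP unfolding good_def by blast
    qed
    note yw = yw_in[OF inn]
    \<comment> \<open>The same count at \<open>w\<close>: if it were unanchored,
      \<open>[w,v]\<close> would be the only segment of \<open>L2\<close> containing it.\<close>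
    have w_anch: "anchored n P L w"
    proof (rule ccontr)
      assume *: "\<not> anchored n P L w"
      then have "w \<notin> pts t" if "t \<in> ?D" for t
        using unanchored_outside[OF pl *] D_sub[OF that] by blast
      then have "t = {w, v}" if "t \<in> L2" "w \<in> pts t" for t
        using that wv unfolding L2' yw(2) by auto
      then show False using good2[of w] * unfolding good_def anchored_def by blast
    qed
    have vL: "split_at v L = L" using False by (intro split_at_id) (auto simp: anchored_def)
    have L2'': "L2 = insert {y, v} (insert {w, v} (split_at w L))"
      unfolding L2' yw(2) vL by blast
    let ?P1 = "insert w P" and ?L1 = "insert {y, w} (split_at w L)"
    have segs: "pts {y, v} \<inter> ?P = {y, v}" "pts {w, v} \<inter> ?P = {w, v}"
      using pl2 L2'' by (simp_all add: planar_def)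
    have "v \<notin> ?P1" using vP vw by blast
    then have ends: "pts {y, w} \<inter> ?P1 = {y, w}"
      unfolding yw(3) using segs y by auto
    have cross: "pts {y, w} \<inter> pts t \<subseteq> ?P1" if t: "t \<in> split_at w L" "t \<noteq> {y, w}" for t
    proof
      fix p assume p: "p \<in> pts {y, w} \<inter> pts t"
      have vt: "v \<notin> pts t" using v_D t(1) vL by simp
      have "t \<in> L2" using t(1) L2'' by simp
      then have "p \<in> t"
      proof -
        have "t \<noteq> {y, v}" "t \<noteq> {w, v}"
          using vt axis_endpoints[OF planar_axis[OF pl2 \<open>t \<in> L2\<close>]] by auto
        moreover have "p \<in> pts {y, v} \<or> p \<in> pts {w, v}" using p yw(3) by blast
        moreover have "{y, v} \<in> L2" "{w, v} \<in> L2" using L2'' by simp_all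
        ultimately show ?thesis
          using planar_meet[OF pl2 \<open>t \<in> L2\<close>, of _ p] p by (metis IntD1 IntD2)
      qed
      then have "p \<in> ?P" "p \<noteq> v" using planar_subset[OF pl2 \<open>t \<in> L2\<close>] vt p by auto
      then show "p \<in> ?P1" by blast
    qed
    note flip = first_flip[OF v y ax(2) w_anch grid(2) ends cross]
    have "split_at v (split_at w L) = split_at w L"
    proof (rule split_at_id)
      fix t assume "t \<in> split_at w L"
      then show "v \<notin> inner t" using v_D vL inner_subset by fastforce
    qed
    \<comment> \<open>The second flip draws \<open>[y,v]\<close> on top of \<open>[y,w]\<close>.
      Cutting \<open>[y,w]\<close> at \<open>v\<close> produces \<open>[y,v]\<close> as well, so the
      effect of this flip is just the cut.\<close>
    then have "insert {y, v} (split_at v ?L1) = L2"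
      unfolding L2'' using split_at_insert[of v "{y, w}" "split_at w L"] yw(1) by simp
    then have "flip_step n (?P1, ?L1) (insert v ?P1, L')"
      using flip(1) y ax(1) v2 sub v' by (intro flip_stepI[of _ _ _ y]) simp_all
    then show ?thesis using flip(2) by blast
  qed
qed

text \<open>If \<open>w\<close> is inside \<open>[y,v]\<close>, then \<open>v\<close> is not inside
  \<open>[y,w]\<close>, and the preceding lemma applies with \<open>v\<close> and \<open>w\<close>
  exchanged.\<close>

lemma two_flips:
  assumes v: "valid n (P, L)" and y: "y \<in> P" and ax: "axis {y, v}" "axis {y, w}" and vw: "v \<noteq> w"
    and L2: "L2 = split_at w (split_at v (insert {y, v} (insert {y, w} L)))"
    and v2: "valid n (insert v (insert w P), L2)"
    and sub: "L' \<subseteq> L2" and v': "valid n (insert v (insert w P), L')"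
  shows "\<exists>R. flip_step n (P, L) R \<and> flip_step n R (insert v (insert w P), L')"
proof (cases "w \<in> inner {y, v}")
  case False
  with assms show ?thesis by (intro two_flips_aux)
next
  case True
  have "y \<noteq> w" using ax(2) by (rule axis_distinct)
  have "v \<notin> inner {y, w}"
  proof
    assume "v \<in> inner {y, w}"
    then have "v \<in> pts {y, w}" by (simp add: inner_def)
    moreover have "{v, y} = {y, v}" by blast
    then have "axis {v, w}"
      using cut_segment(3,4)[of v y w] True ax(1) by simp
    then have "v \<in> pts {v, w}" using axis_endpoints by blast
    ultimately have "v \<in> {w}" using cut_segment(2)[OF ax(1) True] by (metis IntI)
    with vw show False by simp
  qed
  moreover have axL: "\<forall>s\<in>insert {y, v} (insert {y, w} L). axis s"
    using ax planar_axis[of n P L] v unfolding valid_iff by simp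
  have "L2 = split_at v (split_at w (insert {y, w} (insert {y, v} L)))"
    unfolding L2 split_at_commute[OF axL, of w v] by (simp only: insert_commute)
  moreover have "insert w (insert v P) = insert v (insert w P)" by blast
  ultimately show ?thesis
    using two_flips_aux[of n P L y w v L2 L'] v y ax vw v2 sub v' by simp
qed

text \<open>The new segments are perpendicular to both old ones and meet them only in
  \<open>y\<close>. So the old segments contain neither \<open>v\<close> nor \<open>w\<close>,
  survive both cuts unchanged, and can be added to the valid target without a crossing.\<close>

lemma A_flip_flips:
  assumes "A_flip n R R'"
  shows "\<exists>R1. flip_step n R R1 \<and> flip_step n R1 R'"
proof -
  obtain P L P' L' where R: "R = (P, L)" "R' = (P', L')" by (cases R, cases R') auto
  obtain x y z v w where val: "valid n (P, L)" and xy: "{x, y} \<in> L" and yz: "{y, z} \<in> L"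
    and xz: "x \<noteq> z" and vw: "v \<noteq> w" and so: "same_orientation {x, y} {y, z}"
    and o: "other_orientation {x, y} {v, y}" "other_orientation {x, y} {y, w}"
    and P': "P' = P \<union> {v, w}"
    and L': "L' = split_at w (split_at v ((L - {{x, y}, {y, z}}) \<union> {{v, y}, {y, w}}))"
    and v': "valid n (P', L')"
    using assms unfolding A_flip_def R prod.case by metis
  have pl: "planar n P L" and pl': "planar n P' L'" using val v' by (simp_all add: valid_iff)
  have axL: "\<forall>s\<in>L. axis s" using planar_axis[OF pl] by blast
  define K where "K = (L - {{x, y}, {y, z}}) \<union> {{y, v}, {y, w}}"
  have L'K: "L' = split_at w (split_at v K)" unfolding L' K_def by (simp only: insert_commute)
  have perp: "other_orientation {y, u} {y, v}" "other_orientation {y, u} {y, w}" if "u \<in> {x, z}" for u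
  proof -
    have ax: "axis {x, y}" "axis {y, z}" using axL xy yz by simp_all
    have "{x, y} = {y, x}" "{v, y} = {y, v}" by blast+
    then show "other_orientation {y, u} {y, v}" "other_orientation {y, u} {y, w}"
      using that o so ax orientation_exclusive unfolding other_orientation_def same_orientation_def
      by (metis insert_iff singletonD)+
  qed
  have axv: "axis {y, v}" "axis {y, w}" using perp[of x] by (auto simp: other_orientation_def)
  have axK: "\<forall>s\<in>K. axis s" unfolding K_def using axL axv by blast
  have out: "v \<notin> pts {y, u}" "w \<notin> pts {y, u}" if "u \<in> {x, z}" for u
  proof -
    have "v \<in> pts {y, v}" "w \<in> pts {y, w}" "v \<noteq> y" "w \<noteq> y"
      using axv axis_endpoints axis_distinct by blast+
    then show "v \<notin> pts {y, u}" "w \<notin> pts {y, u}"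
      using perpendicular_meet[OF perp(1)[OF that]] perpendicular_meet[OF perp(2)[OF that]]
      by (metis IntI singletonD)+
  qed
  have yuL: "{y, u} \<in> L" if "u \<in> {x, z}" for u using that xy yz by (auto simp: insert_commute)
  have ends: "pts {y, u} \<inter> P' = {y, u}" if "u \<in> {x, z}" for u
  proof -
    have "pts {y, u} \<inter> P = {y, u}" using pl yuL[OF that] by (simp add: planar_def)
    then show ?thesis unfolding P' using out[OF that] by auto
  qed
  have cross: "pts {y, u} \<inter> pts t \<subseteq> P'" if "u \<in> {x, z}" "t \<in> L'" for u t
  proof -
    have "\<forall>s\<in>split_at v K. axis s" using split_at_source[OF _ axK] by blast
    with that(2) obtain s where s: "s \<in> split_at v K" "pts t \<subseteq> pts s"
      unfolding L'K by (rule split_at_source)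
    from s(1) axK obtain s' where s': "s' \<in> K" "pts s \<subseteq> pts s'" by (rule split_at_source)
    have "pts {y, u} \<inter> pts s' \<subseteq> P"
    proof (cases "s' \<in> {{y, v}, {y, w}}")
      case True
      then show ?thesis
        using perpendicular_meet[OF perp(1)[OF that(1)]] perpendicular_meet[OF perp(2)[OF that(1)]]
          planar_subset[OF pl yuL[OF that(1)]] by auto
    next
      case False
      then have "s' \<in> L" "s' \<noteq> {y, u}"
        using s'(1) that(1) unfolding K_def by (auto simp: insert_commute)
      then show ?thesis using planar_cross[OF pl yuL[OF that(1)]] by simp
    qed
    then show ?thesis using s(2) s'(2) P' by blast
  qed
  \<comment> \<open>The segments after both flips and before any removal; they turn out to be the
    target with the two old segments put back.\<close>
  define L2 where "L2 = split_at w (split_at v (insert {y, v} (insert {y, w} L)))"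
  have "{y, x} \<noteq> {y, z}" using xz by (simp add: doubleton_eq_iff)
  have L2: "L2 = insert {y, x} (insert {y, z} L')"
  proof -
    have "split_at w (split_at v {{y, u}}) = {{y, u}}" if "u \<in> {x, z}" for u
      using out[OF that] by (simp add: split_at_outside inner_def)
    then have "split_at w (split_at v {{y, x}}) = {{y, x}}"
      "split_at w (split_at v {{y, z}}) = {{y, z}}" by simp_all
    moreover have "insert {y, v} (insert {y, w} L) = {{y, x}} \<union> ({{y, z}} \<union> K)"
      unfolding K_def using yuL[of x] yuL[of z] by (auto simp: insert_commute)
    then have "L2 = split_at w (split_at v {{y, x}}) \<union> (split_at w (split_at v {{y, z}}) \<union> L')"
      unfolding L2_def L'K by (simp only: split_at_Un)
    ultimately show ?thesis by (simp add: insert_commute)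
  qed
  have "planar n P' (insert {y, z} L')"
    by (rule planar_insert[OF pl' _ ends cross]) (use axL yuL[of z] in simp_all)
  with v' have "valid n (P', insert {y, z} L')" by (rule valid_insert)
  moreover from this have "planar n P' (insert {y, z} L')" by (simp add: valid_iff)
  moreover have "pts {y, x} \<inter> pts t \<subseteq> P'" if "t \<in> insert {y, z} L'" for t
    using that cross[of x t] planar_cross[OF pl yuL[of x] yuL[of z]] \<open>{y, x} \<noteq> {y, z}\<close> P' by auto
  ultimately have "valid n (P', L2)"
    unfolding L2 using planar_insert[of n P' "insert {y, z} L'" "{y, x}"] ends[of x] axL yuL[of x]
    by (simp add: valid_insert)
  moreover have "P' = insert v (insert w P)" unfolding P' by blast
  moreover have "y \<in> P" using planar_subset[OF pl xy] by simp
  moreover have "L' \<subseteq> L2" unfolding L2 by blast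
  ultimately show ?thesis
    using two_flips[OF val _ axv vw L2_def] v' unfolding R by simp
qed

lemma A_steps_flip_steps:
  assumes "(A_step n ^^ k) R R'"
  shows "\<exists>m \<le> 2 * k. (flip_step n ^^ m) R R'"
  using assms
proof (induction k arbitrary: R')
  case 0
  then show ?case by (auto intro: exI[of _ 0])
next
  case (Suc k)
  then obtain Q where Q: "(A_step n ^^ k) R Q" "A_step n Q R'" by auto
  from Suc.IH[OF Q(1)] obtain m where m: "m \<le> 2 * k" "(flip_step n ^^ m) R Q" by blast
  from Q(2) consider "flip_step n Q R'" | Q1 where "flip_step n Q Q1" "flip_step n Q1 R'"
    unfolding A_step_def using A_rotate_flip A_flip_flips by blast
  then show ?case
  proof cases
    case 1
    then have "(flip_step n ^^ Suc m) R R'" using m(2) by auto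
    then show ?thesis using m(1) by (intro exI[of _ "Suc m"]) simp
  next
    case 2
    then have "(flip_step n ^^ Suc (Suc m)) R R'" using m(2) by auto
    then show ?thesis using m(1) by (intro exI[of _ "Suc (Suc m)"]) simp
  qed
qed

section \<open>Effect of removals and rotations on unit edges\<close>

lemma edge_remove:
  assumes pl: "planar n P L" and s: "s \<in> L" and pq: "p \<noteq> q"
  shows "edge (L - {s}) p q \<longleftrightarrow> edge L p q \<and> \<not> (p \<in> pts s \<and> q \<in> pts s)"
proof -
  \<comment> \<open>Two different segments of a planar state cannot share two points: both would be
    common endpoints, which makes the segments equal. Removing \<open>s\<close> thus uncovers every
    edge on it.\<close>
  have "s' = s" if "s' \<in> L" "p \<in> pts s'" "q \<in> pts s'" "p \<in> pts s" "q \<in> pts s" for s'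
  proof (rule ccontr)
    assume "s' \<noteq> s"
    then have m: "p \<in> s' \<inter> s" "q \<in> s' \<inter> s" using planar_meet[OF pl that(1) s] that by blast+
    have "t = {p, q}" if "axis t" "p \<in> t" "q \<in> t" for t
      using axis_doubleton[OF that(1,2)] that(3) pq by (metis insertE singletonD)
    then have "s' = {p, q}" "s = {p, q}" using m planar_axis[OF pl] that(1) s by blast+
    with \<open>s' \<noteq> s\<close> show False by simp
  qed
  then show ?thesis unfolding edge_def using s by blast
qed

lemma edge_vertical_segment:
  assumes "axis s" "(k, y) \<in> pts s" "(k, Suc y) \<in> pts s"
  obtains a b where "s = {(k, a), (k, b)}" "a \<le> y" "y < b" "pts s = {k} \<times> {a..b}"
  using assms(1)
proof (cases rule: axis_cases)
  case (horizontal a b r)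
  then show ?thesis using assms(2,3) by auto
next
  case (vertical r a b)
  then show ?thesis using assms(2,3) that[of a b] by auto
qed

lemma edge_vertical_iff:
  assumes "\<forall>s\<in>L. axis s"
  shows "edge L (k, y) (k, Suc y) \<longleftrightarrow> (\<exists>a b. {(k, a), (k, b)} \<in> L \<and> a \<le> y \<and> y < b)"
proof
  assume "edge L (k, y) (k, Suc y)"
  then obtain s where s: "s \<in> L" "(k, y) \<in> pts s" "(k, Suc y) \<in> pts s" unfolding edge_def by blast
  then have "axis s" using assms by simp
  then obtain a b where "s = {(k, a), (k, b)}" "a \<le> y" "y < b"
    using s(2,3) by (rule edge_vertical_segment)
  with s(1) show "\<exists>a b. {(k, a), (k, b)} \<in> L \<and> a \<le> y \<and> y < b" by blast
next
  assume "\<exists>a b. {(k, a), (k, b)} \<in> L \<and> a \<le> y \<and> y < b"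
  then obtain a b where ab: "{(k, a), (k, b)} \<in> L" "a \<le> y" "y < b" by blast
  then have "(k, y) \<in> pts {(k, a), (k, b)}" "(k, Suc y) \<in> pts {(k, a), (k, b)}"
    by (simp_all add: pts_vertical)
  with ab(1) show "edge L (k, y) (k, Suc y)" unfolding edge_def by blast
qed

text \<open>The new segment has length one and therefore no grid point in its interior, so it can
  neither contain a further point of \<open>P\<close> nor create a crossing outside
  \<open>P\<close>. The heights \<open>t\<close> and \<open>b\<close> may come in either order, as
  segments are rotated at both ends of a column.\<close>

lemma rotate_right:
  assumes pl: "planar n P L" and s: "{(j, t), (j, b)} \<in> L" and z: "(Suc j, t) \<in> grid n - corners n"
    and L': "L' = split_at (Suc j, t) ((L - {{(j, t), (j, b)}}) \<union> {{(j, t), (Suc j, t)}})"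
  shows "planar n (insert (Suc j, t) P) L'"
    and "\<And>p q. q = (Suc (fst p), snd p) \<or> q = (fst p, Suc (snd p)) \<Longrightarrow>
       edge L' p q \<longleftrightarrow> edge L p q \<and> \<not> (p \<in> pts {(j, t), (j, b)} \<and> q \<in> pts {(j, t), (j, b)}) \<or>
         p = (j, t) \<and> q = (Suc j, t)"
proof -
  let ?s = "{(j, t), (j, b)}" and ?e = "{(j, t), (Suc j, t)}"
  have pts_e: "pts ?e = ?e" by (auto simp: pts_horizontal)
  have L'2: "L' = insert ?e (split_at (Suc j, t) (L - {?s}))"
    unfolding L' split_at_Un using split_at_outside[of "(Suc j, t)" ?e] by (simp add: inner_def pts_e)
  have plK: "planar n P (L - {?s})" using pl by (rule planar_mono) blast
  have "(j, t) \<in> P" using planar_subset[OF pl s] by simp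
  have "horizontal ?e" by (rule horizontal_pair) simp
  then show "planar n (insert (Suc j, t) P) L'"
    unfolding L'2 using planar_split[OF plK z] \<open>(j, t) \<in> P\<close>
    by (intro planar_insert) (auto simp: pts_e)
  fix p q :: point assume pq: "q = (Suc (fst p), snd p) \<or> q = (fst p, Suc (snd p))"
  have axK: "\<forall>s\<in>L - {?s}. axis s" using planar_axis[OF plK] by blast
  have "p \<noteq> q" using pq by (cases p) auto
  have "p \<in> pts ?e \<and> q \<in> pts ?e \<longleftrightarrow> p = (j, t) \<and> q = (Suc j, t)"
    using pq unfolding pts_e by (cases p) auto
  then show "edge L' p q \<longleftrightarrow> edge L p q \<and> \<not> (p \<in> pts ?s \<and> q \<in> pts ?s) \<or> p = (j, t) \<and> q = (Suc j, t)"
    unfolding L'2 edge_insert edge_split[OF axK pq] edge_remove[OF pl s \<open>p \<noteq> q\<close>] by blast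
qed

section \<open>The column sweep\<close>

locale column_sweep =
  fixes n :: nat and x :: "nat \<Rightarrow> nat"
  assumes bij: "bij_betw x {1..n} {1..n}"
begin

definition X :: "point set" where
  "X = {(x i, i) | i. i \<in> {1..n}}"

definition row :: "nat \<Rightarrow> nat" where
  "row = inv_into {1..n} x"

lemma row: "1 \<le> j \<Longrightarrow> j \<le> n \<Longrightarrow> 1 \<le> row j \<and> row j \<le> n \<and> x (row j) = j"
  using bij inv_into_into[of j x "{1..n}"] f_inv_into_f[of j x "{1..n}"]
  unfolding row_def bij_betw_def by auto

lemma x_range: "1 \<le> y \<Longrightarrow> y \<le> n \<Longrightarrow> 1 \<le> x y \<and> x y \<le> n"
  using bij by (auto simp: bij_betw_def)

lemma x_inj: "1 \<le> y \<Longrightarrow> y \<le> n \<Longrightarrow> 1 \<le> y' \<Longrightarrow> y' \<le> n \<Longrightarrow> x y = x y' \<longleftrightarrow> y = y'"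
  using bij inj_on_eq_iff[of x "{1..n}" y y'] unfolding bij_betw_def by simp

lemma x_eq_iff: "1 \<le> y \<Longrightarrow> y \<le> n \<Longrightarrow> 1 \<le> j \<Longrightarrow> j \<le> n \<Longrightarrow> x y = j \<longleftrightarrow> y = row j"
  using bij row[of j] unfolding bij_betw_def inj_on_def by (metis atLeastAtMost_iff)

text \<open>The last set collects the crossings of row \<open>y\<close> with the columns to the
  right of its point of \<open>X\<close>, as far as the row has been drawn. Left of that point a row
  leaves no crossings, since the columns there have been cleared when the row is drawn.\<close>

definition points :: "nat \<Rightarrow> nat \<Rightarrow> nat \<Rightarrow> point set" where
  "points j lo hi = X \<union> margin n \<union>
     {(k, y). y \<in> {1..n} \<and> x y < k \<and> (k \<le> j \<or> k = Suc j \<and> (y \<le> lo \<or> hi \<le> y))}"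

text \<open>The stage of the sweep in which the columns left of \<open>j\<close> carry no vertical segments any more
  and column \<open>j\<close> carries them only between the heights \<open>lo\<close> and \<open>hi\<close>.\<close>

definition stage :: "nat \<Rightarrow> nat \<Rightarrow> nat \<Rightarrow> state \<Rightarrow> bool" where
  "stage j lo hi = (\<lambda>(P, L). planar n P L \<and> P = points j lo hi \<and>
     (\<forall>k y. edge L (k, y) (Suc k, y) \<longleftrightarrow>
        1 \<le> y \<and> y \<le> n \<and> x y < j \<and> (k < j \<or> k = j \<and> (y \<le> lo \<or> hi \<le> y))) \<and>
     (\<forall>k y. edge L (k, y) (k, Suc y) \<longleftrightarrow>
        1 \<le> k \<and> k \<le> n \<and> y \<le> n \<and> (j < k \<or> k = j \<and> lo \<le> y \<and> y < hi)))"

lemma points_iff: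
  "1 \<le> k \<Longrightarrow> k \<le> n \<Longrightarrow> 1 \<le> y \<Longrightarrow> y \<le> n \<Longrightarrow> (k, y) \<in> points j lo hi \<longleftrightarrow>
     x y = k \<or> x y < k \<and> (k \<le> j \<or> k = Suc j \<and> (y \<le> lo \<or> hi \<le> y))"
  unfolding points_def X_def margin_def by auto

lemma stageD:
  assumes "stage j lo hi (P, L)"
  shows "planar n P L" "P = points j lo hi"
    "edge L (k, y) (Suc k, y) \<longleftrightarrow>
        1 \<le> y \<and> y \<le> n \<and> x y < j \<and> (k < j \<or> k = j \<and> (y \<le> lo \<or> hi \<le> y))"
    "edge L (k, y) (k, Suc y) \<longleftrightarrow>
        1 \<le> k \<and> k \<le> n \<and> y \<le> n \<and> (j < k \<or> k = j \<and> lo \<le> y \<and> y < hi)"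
  using assms unfolding stage_def prod.case by blast+

text \<open>Through a point left of column \<open>j\<close> its row runs straight. In column
  \<open>j\<close> the row does so at heights up to \<open>lo\<close> and from \<open>hi\<close> on,
  and the column does so strictly in between, where hypothesis \<open>c\<close> places the point of
  \<open>X\<close>. Columns further right are still complete.\<close>

lemma stage_valid:
  assumes st: "stage j lo hi (P, L)" and c: "j \<le> n \<Longrightarrow> lo < row j \<and> row j < hi"
    and j: "1 \<le> j"
  shows "valid n (P, L)"
proof -
  note pl = stageD(1)[OF st] and H = stageD(3)[OF st] and V = stageD(4)[OF st]
  have "good L p" if p: "p \<in> P \<inter> ({1..n} \<times> {1..n})" for p
  proof -
    have "p = (Suc (fst p - 1), Suc (snd p - 1))" using p by (cases p) auto
    then obtain k y where ky: "p = (Suc k, Suc y)" by blast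
    have k: "Suc k \<le> n" "Suc y \<le> n" using p ky by auto
    have P: "x (Suc y) = Suc k \<or> x (Suc y) < Suc k \<and> (Suc k \<le> j \<or> Suc k = Suc j \<and> (Suc y \<le> lo \<or> hi \<le> Suc y))"
      using p ky k points_iff[of "Suc k" "Suc y" j lo hi] unfolding stageD(2)[OF st] by simp
    have "x (Suc y) = Suc k \<and> j = Suc k \<longrightarrow> Suc y = row j"
      using x_eq_iff[of "Suc y" "Suc k"] k by auto
    moreover have "j = Suc k \<longrightarrow> lo < row (Suc k) \<and> row (Suc k) < hi" using c k by blast
    ultimately show ?thesis
      using P k unfolding ky by (subst good_iff_edges[OF pl]) (use p ky in \<open>auto simp: H V\<close>)
  qed
  with pl show ?thesis by (simp add: valid_iff)
qed

text \<open>No point of \<open>X\<close> lies left of column 1, so this stage has no horizontal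
  edges and no crossing points, and its vertical edges fill all columns.\<close>

lemma initial_stage: "stage 1 0 (Suc n) (initial_state n X)"
proof -
  define P L where "P = X \<union> margin n"
    and "L = (\<Union>(a, b)\<in>X. {{(a, 0), (a, b)}, {(a, b), (a, n + 1)}})"
  have X_image: "X = (\<lambda>i. (x i, i)) ` {1..n}" unfolding X_def by blast
  define lower upper where "lower i = {(x i, 0), (x i, i)}" and "upper i = {(x i, i), (x i, Suc n)}" for i
  have "L = (\<Union>i\<in>{1..n}. {lower i, upper i})"
    unfolding L_def X_image lower_def upper_def by simp
  then have L_iff: "s \<in> L \<longleftrightarrow> (\<exists>i. 1 \<le> i \<and> i \<le> n \<and> (s = lower i \<or> s = upper i))" for s
    by (simp add: Bex_def conj_assoc)
  have P_eq: "points 1 0 (Suc n) = P"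
  proof -
    have "\<not> (y \<in> {1..n} \<and> x y < k \<and> (k \<le> 1 \<or> k = Suc 1 \<and> (y \<le> 0 \<or> Suc n \<le> y)))" for k y
      using x_range[of y] by auto
    then have "{(k, y). y \<in> {1..n} \<and> x y < k \<and> (k \<le> 1 \<or> k = Suc 1 \<and> (y \<le> 0 \<or> Suc n \<le> y))} = {}"
      by blast
    then show ?thesis unfolding points_def P_def by (simp only: Un_empty_right)
  qed
  have pts: "pts (lower i) = {x i} \<times> {0..i}" "i \<le> n \<Longrightarrow> pts (upper i) = {x i} \<times> {i..Suc n}" for i
    by (simp_all add: pts_vertical lower_def upper_def)
  have col: "(x i, y) \<in> P \<longleftrightarrow> y = 0 \<or> y = i \<or> y = Suc n" if i: "1 \<le> i" "i \<le> n" and "y \<le> Suc n" for i y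
  proof -
    have "(x i, y) \<in> X \<longleftrightarrow> (1 \<le> y \<and> y \<le> n \<and> x i = x y)" unfolding X_image by auto
    then have "(x i, y) \<in> X \<longleftrightarrow> y = i" using x_inj[OF i, of y] i by metis
    moreover have "(x i, y) \<in> margin n \<longleftrightarrow> y = 0 \<or> y = Suc n"
      using x_range[OF i] that(3) unfolding margin_def by auto
    ultimately show ?thesis unfolding P_def Un_iff by argo
  qed
  have segs: "vertical (lower i)" "vertical (upper i)"
    "pts (lower i) \<inter> P = lower i" "pts (upper i) \<inter> P = upper i" if i: "1 \<le> i" "i \<le> n" for i
  proof -
    show "vertical (lower i)" "vertical (upper i)"
      unfolding lower_def upper_def using i by (simp_all add: vertical_pair)
    have "q \<in> pts (lower i) \<inter> P \<longleftrightarrow> q \<in> lower i" for q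
      using col[OF i, of "snd q"] i unfolding pts(1) by (cases q) (auto simp: lower_def)
    then show "pts (lower i) \<inter> P = lower i" by blast
    have "q \<in> pts (upper i) \<inter> P \<longleftrightarrow> q \<in> upper i" for q
      using col[OF i, of "snd q"] i unfolding pts(2)[OF i(2)] by (cases q) (auto simp: upper_def)
    then show "pts (upper i) \<inter> P = upper i" by blast
  qed
  have 1: "is_state n (P, L)"
  proof -
    have "X \<subseteq> grid n - corners n"
    proof
      fix p assume "p \<in> X"
      then obtain i where "1 \<le> i" "i \<le> n" "p = (x i, i)" unfolding X_def by auto
      then show "p \<in> grid n - corners n" using x_range[of i] by (simp add: grid_def corners_def)
    qed
    moreover have "margin n \<subseteq> grid n - corners n" by (auto simp: margin_def grid_def corners_def)
    ultimately have "P \<subseteq> grid n - corners n" unfolding P_def by blast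
    moreover have "vertical s \<and> s \<subseteq> P" if "s \<in> L" for s
      using that segs unfolding L_iff by blast
    ultimately show ?thesis unfolding is_state_def prod.case by blast
  qed
  have 2: "pts s \<inter> P = s" if "s \<in> L" for s
    using that segs unfolding L_iff by metis
  have sub: "\<exists>i. 1 \<le> i \<and> i \<le> n \<and> (s = lower i \<and> pts s = {x i} \<times> {0..i} \<or>
      s = upper i \<and> pts s = {x i} \<times> {i..Suc n})" if "s \<in> L" for s
    using that pts unfolding L_iff by metis
  have 3: "pts s \<inter> pts t \<subseteq> P" if st: "s \<in> L" "t \<in> L" "s \<noteq> t" for s t
  proof -
    obtain i where i: "1 \<le> i" "i \<le> n" "s = lower i \<and> pts s = {x i} \<times> {0..i} \<or>
      s = upper i \<and> pts s = {x i} \<times> {i..Suc n}" using sub[OF st(1)] by metis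
    obtain i' where i': "1 \<le> i'" "i' \<le> n" "t = lower i' \<and> pts t = {x i'} \<times> {0..i'} \<or>
      t = upper i' \<and> pts t = {x i'} \<times> {i'..Suc n}" using sub[OF st(2)] by metis
    show ?thesis
    proof (cases "i = i'")
      case True
      then have "pts s \<inter> pts t \<subseteq> {(x i, i)}" using i(3) i'(3) st(3) by auto
      moreover have "(x i, i) \<in> P" using col[OF i(1,2), of i] i(2) by simp
      ultimately show ?thesis by blast
    next
      case False
      then have "x i \<noteq> x i'" using x_inj i(1,2) i'(1,2) by metis
      then show ?thesis using i(3) i'(3) by auto
    qed
  qed
  have pl: "planar n P L" using 1 2 3 by (simp add: planar_def)
  have H: "\<not> edge L (k, y) (Suc k, y)" for k y
  proof
    assume "edge L (k, y) (Suc k, y)"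
    then obtain s where s: "s \<in> L" "(k, y) \<in> pts s" "(Suc k, y) \<in> pts s" unfolding edge_def by blast
    then show False using sub[OF s(1)] by auto
  qed
  have V: "edge L (k, y) (k, Suc y) \<longleftrightarrow> 1 \<le> k \<and> k \<le> n \<and> y \<le> n" for k y
  proof
    assume "edge L (k, y) (k, Suc y)"
    then obtain s where s: "s \<in> L" "(k, y) \<in> pts s" "(k, Suc y) \<in> pts s" unfolding edge_def by blast
    from sub[OF s(1)] obtain i where i: "1 \<le> i" "i \<le> n"
      "pts s = {x i} \<times> {0..i} \<or> pts s = {x i} \<times> {i..Suc n}" by metis
    then show "1 \<le> k \<and> k \<le> n \<and> y \<le> n" using s(2,3) x_range[OF i(1,2)] by auto
  next
    assume k: "1 \<le> k \<and> k \<le> n \<and> y \<le> n"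
    then have r: "1 \<le> row k" "row k \<le> n" "x (row k) = k" using row by blast+
    define s where "s = (if y < row k then lower (row k) else upper (row k))"
    have "s \<in> L" unfolding L_iff s_def using r by (intro exI[of _ "row k"]) simp
    moreover have "(k, y) \<in> pts s" "(k, Suc y) \<in> pts s"
      unfolding s_def using k r pts(1)[of "row k"] pts(2)[of "row k"] by simp_all
    ultimately show "edge L (k, y) (k, Suc y)" unfolding edge_def by blast
  qed
  show ?thesis
    unfolding stage_def initial_state_def prod.case P_def[symmetric] L_def[symmetric]
  proof (intro conjI allI)
    show "planar n P L" by (rule pl)
    show "P = points 1 0 (Suc n)" using P_eq by simp
    fix k y
    show "edge L (k, y) (Suc k, y) \<longleftrightarrow>
        1 \<le> y \<and> y \<le> n \<and> x y < 1 \<and> (k < 1 \<or> k = 1 \<and> (y \<le> 0 \<or> Suc n \<le> y))"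
      using H[of k y] x_range[of y] by auto
    show "edge L (k, y) (k, Suc y) \<longleftrightarrow>
        1 \<le> k \<and> k \<le> n \<and> y \<le> n \<and> (1 < k \<or> k = 1 \<and> 0 \<le> y \<and> y < Suc n)"
      using V[of k y] by auto
  qed
qed

text \<open>Here the right margin plays the part of column \<open>j\<close>. Every point of
  \<open>X\<close> lies to its left, so all rows reach it; none goes beyond, because the heights 1
  to \<open>n\<close> lie strictly between 0 and \<open>Suc n\<close>. Vertical edges exist only in
  columns up to \<open>n\<close>, so none is left.\<close>

lemma final_stage:
  assumes st: "stage (Suc n) 0 (Suc n) (P, L)"
  shows "end_state n X (P, L)"
proof -
  have pl: "planar n P L" and P: "P = points (Suc n) 0 (Suc n)"
    and H: "\<And>k y. edge L (k, y) (Suc k, y) \<longleftrightarrow> 1 \<le> y \<and> y \<le> n \<and> x y < Suc n \<and> k < Suc n"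
    and V: "\<And>k y. \<not> edge L (k, y) (k, Suc y)"
    using stageD[OF st] by auto
  have "valid n (P, L)" using stage_valid[OF st] by simp
  moreover have "X \<union> margin n \<subseteq> P" unfolding P points_def by blast
  moreover have "horizontal s" if "s \<in> L" for s
    using planar_axis[OF pl that]
  proof (cases rule: axis_cases)
    case (vertical r a b)
    then have "(r, a) \<in> pts s" "(r, Suc a) \<in> pts s" by auto
    then show ?thesis using V that unfolding edge_def by blast
  qed
  moreover have "(k, y) \<in> (\<Union>s\<in>L. pts s)" if "k \<le> Suc n" "1 \<le> y" "y \<le> n" for k y
  proof (cases "k = Suc n")
    \<comment> \<open>No edge starts at the right margin, so its points are covered as right ends of
      edges from column \<open>n\<close>.\<close>
    case True
    have "edge L (n, y) (Suc n, y)" using H x_range[of y] that by auto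
    then show ?thesis using True unfolding edge_def by blast
  next
    case False
    then have "edge L (k, y) (Suc k, y)" using H x_range[of y] that by auto
    then show ?thesis unfolding edge_def by blast
  qed
  ultimately show ?thesis unfolding end_state_def prod.case by auto
qed

section \<open>Rotations and the flip within one column\<close>

lemma stage_column_points:
  assumes "stage j lo hi (P, L)" "(j, y) \<in> P" "1 \<le> y" "y \<le> n" "1 \<le> j" "j \<le> n"
  shows "x y \<le> j"
  using assms(2) points_iff[OF assms(5,6,3,4), of j lo hi] unfolding stageD(2)[OF assms(1)] by auto

lemma stage_column_gap:
  assumes "stage j lo hi (P, L)" "(j, y) \<notin> P" "1 \<le> y" "y \<le> n" "1 \<le> j" "j \<le> n"
  shows "j < x y"
  using assms(2) points_iff[OF assms(5,6,3,4), of j lo hi] unfolding stageD(2)[OF assms(1)] by auto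

text \<open>The two cases of \<open>tb\<close> are the lowest and the highest vertical segment of
  the column; \<open>b\<close> is its outer end and \<open>t\<close> its inner end. Row
  \<open>t\<close> arrives from the left and is prolonged to the next column, while the bound at
  \<open>b\<close> moves to \<open>t\<close>.\<close>

lemma stage_rotate:
  assumes st: "stage j lo hi (P, L)" and j: "1 \<le> j" "j \<le> n"
    and c: "lo < row j" "row j < hi" "hi \<le> Suc n"
    and s: "{(j, t), (j, b)} \<in> L"
    and tb: "b = lo \<and> lo < t \<and> t < row j \<and> lo' = t \<and> hi' = hi \<or>
      b = hi \<and> row j < t \<and> t < hi \<and> lo' = lo \<and> hi' = t"
  shows "\<exists>P' L'. A_rotate n (P, L) (P', L') \<and> stage j lo' hi' (P', L')"
proof -
  note pl = stageD(1)[OF st] and H = stageD(3)[OF st] and V = stageD(4)[OF st]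
  let ?s = "{(j, t), (j, b)}"
  have t: "1 \<le> t" "t \<le> n" using tb c row[OF j] by auto
  have pts_s: "pts ?s = {j} \<times> {min t b..max t b}"
  proof (cases "t \<le> b")
    case True
    then show ?thesis by (simp add: pts_vertical min_def max_def)
  next
    case False
    then have "pts {(j, b), (j, t)} = {j} \<times> {b..t}" by (simp add: pts_vertical)
    with False show ?thesis by (simp add: insert_commute min_def max_def)
  qed
  have ends: "(j, t) \<in> P" "(j, b) \<in> P" using planar_subset[OF pl s] by simp_all
  have gap: "j < x y" if y: "min t b < y" "y < max t b" for y
  proof -
    have "(j, y) \<notin> P"
    proof
      assume "(j, y) \<in> P"
      moreover have "(j, y) \<in> pts ?s" unfolding pts_s using y by simp
      ultimately have "(j, y) \<in> ?s" by (rule planar_endpoint[OF pl s])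
      then show False using y by (simp add: min_def max_def split: if_splits)
    qed
    moreover have "1 \<le> y" "y \<le> n" using y t c(3) tb by (auto simp: min_def max_def split: if_splits)
    ultimately show ?thesis using stage_column_gap[OF st] j by blast
  qed
  have "t \<noteq> row j" using tb by auto
  then have "x t \<noteq> j" using x_eq_iff[OF t j] by simp
  moreover have "x t \<le> j" using stage_column_points[OF st ends(1) t j] .
  ultimately have xt: "x t < j" by simp
  \<comment> \<open>A row whose height is strictly inside the removed segment has its point of
    \<open>X\<close> further right, so among the rows that have reached column \<open>j\<close> the
    moved bound affects row \<open>t\<close> only.\<close>
  have key: "(y \<le> lo' \<or> hi' \<le> y) \<longleftrightarrow> y = t \<or> y \<le> lo \<or> hi \<le> y" if "x y \<le> j" for y
  proof -
    have "\<not> (min t b < y \<and> y < max t b)" using gap[of y] that by linarith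
    then show ?thesis using tb c by (elim disjE conjE) (auto simp: min_def max_def)
  qed
  define P' where "P' = insert (Suc j, t) P"
  define L' where "L' = split_at (Suc j, t) ((L - {?s}) \<union> {{(j, t), (Suc j, t)}})"
  have "(Suc j, t) \<in> grid n - corners n" using j t by (auto simp: grid_def corners_def)
  note rot = rotate_right[OF pl s this L'_def]
  have st': "stage j lo' hi' (P', L')"
    unfolding stage_def prod.case
  proof (intro conjI allI)
    show "planar n P' L'" unfolding P'_def by (rule rot(1))
    show "P' = points j lo' hi'"
    proof (rule set_eqI)
      fix q :: point
      obtain k y where q: "q = (k, y)" by (cases q)
      have "y \<in> {1..n} \<and> x y < k \<and> (k \<le> j \<or> k = Suc j \<and> (y \<le> lo' \<or> hi' \<le> y)) \<longleftrightarrow>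
          y \<in> {1..n} \<and> x y < k \<and> (k \<le> j \<or> k = Suc j \<and> (y \<le> lo \<or> hi \<le> y)) \<or> k = Suc j \<and> y = t"
        using key[of y] xt t by (cases "k = Suc j") auto
      then show "q \<in> P' \<longleftrightarrow> q \<in> points j lo' hi'"
        unfolding P'_def stageD(2)[OF st] points_def q Un_iff insert_iff mem_Collect_eq prod.case prod.inject
        by blast
    qed
    fix k y
    have "edge L' (k, y) (Suc k, y) \<longleftrightarrow> edge L (k, y) (Suc k, y) \<or> k = j \<and> y = t"
      using rot(2)[of "(Suc k, y)" "(k, y)"] unfolding pts_s by auto
    then show "edge L' (k, y) (Suc k, y) \<longleftrightarrow>
        1 \<le> y \<and> y \<le> n \<and> x y < j \<and> (k < j \<or> k = j \<and> (y \<le> lo' \<or> hi' \<le> y))"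
      unfolding H using key[of y] xt t by (cases "k = j") auto
    have "edge L' (k, y) (k, Suc y) \<longleftrightarrow>
        edge L (k, y) (k, Suc y) \<and> \<not> (k = j \<and> min t b \<le> y \<and> y < max t b)"
      using rot(2)[of "(k, Suc y)" "(k, y)"] unfolding pts_s by auto
    then show "edge L' (k, y) (k, Suc y) \<longleftrightarrow>
        1 \<le> k \<and> k \<le> n \<and> y \<le> n \<and> (j < k \<or> k = j \<and> lo' \<le> y \<and> y < hi')"
      unfolding V using tb c by (auto simp: min_def max_def)
  qed
  have c': "lo' < row j" "row j < hi'" using tb c by auto
  have "axis ?s" using planar_axis[OF pl s] .
  then have "vertical ?s" using pts_s
  proof (cases rule: axis_cases)
    case (horizontal a b' y)
    then have "{(a, y), (b', y)} = ?s" by simp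
    then show ?thesis using horizontal(1) by (auto simp: doubleton_eq_iff)
  qed
  then have "other_orientation ?s {(j, t), (Suc j, t)}"
    using horizontal_pair[of j "Suc j" t] by (simp add: other_orientation_def)
  then have "A_rotate n (P, L) (P', L')"
    unfolding A_rotate_def prod.case
    using stage_valid[OF st _ j(1)] stage_valid[OF st' _ j(1)] c c' s L'_def P'_def
    by (intro conjI exI[of _ "(j, t)"] exI[of _ "(j, b)"] exI[of _ "(Suc j, t)"]) simp_all
  with st' show ?thesis by blast
qed

text \<open>Row \<open>r\<close> is drawn to the left margin in one piece, because nothing lies on
  it left of its point of \<open>X\<close>; on the right it stops at the next column, like the
  rotated rows.\<close>

lemma stage_flip:
  assumes st: "stage j lo hi (P, L)" and j: "1 \<le> j" "j \<le> n"
    and c: "lo < row j" "row j < hi" "hi \<le> Suc n"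
    and s1: "{(j, lo), (j, row j)} \<in> L" and s2: "{(j, row j), (j, hi)} \<in> L"
  shows "\<exists>P' L'. A_flip n (P, L) (P', L') \<and> stage (Suc j) 0 (Suc n) (P', L')"
proof -
  note pl = stageD(1)[OF st] and H = stageD(3)[OF st] and V = stageD(4)[OF st]
  define r where "r = row j"
  note c = c[folded r_def]
  have r: "1 \<le> r" "r \<le> n" "x r = j" using row[OF j] unfolding r_def by simp_all
  let ?s1 = "{(j, lo), (j, r)}" and ?s2 = "{(j, r), (j, hi)}"
  let ?e = "{(j, r), (Suc j, r)}" and ?f = "{(0, r), (j, r)}"
  have s: "?s1 \<in> L" "?s2 \<in> L" using s1 s2 unfolding r_def by simp_all
  have pts: "pts ?s1 = {j} \<times> {lo..r}" "pts ?s2 = {j} \<times> {r..hi}" "pts ?e = ?e" "pts ?f = {0..j} \<times> {r}"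
    using c by (auto simp: pts_vertical pts_horizontal)
  have "?s1 \<noteq> ?s2" using c by (simp add: doubleton_eq_iff)
  have gap: "j < x y" if y: "lo < y" "y < hi" "y \<noteq> r" for y
  proof -
    have "(j, y) \<notin> P"
    proof
      assume "(j, y) \<in> P"
      moreover have "(j, y) \<in> pts ?s1 \<or> (j, y) \<in> pts ?s2" unfolding pts using y by auto
      ultimately have "(j, y) \<in> ?s1 \<or> (j, y) \<in> ?s2"
        using planar_endpoint[OF pl s(1)] planar_endpoint[OF pl s(2)] by blast
      then show False using y by auto
    qed
    then show ?thesis using stage_column_gap[OF st _ _ _ j, of y] y c(3) by simp
  qed
  \<comment> \<open>All other rows with their point at or left of column \<open>j\<close> have
    already been prolonged to the next column, so after the flip the bounds can be reset to 0 and
    \<open>Suc n\<close>.\<close>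
  have key: "y \<le> lo \<or> hi \<le> y \<or> y = r" if "x y \<le> j" for y
    using gap[of y] that by linarith
  define K where "K = L - {?s1, ?s2}"
  have plK: "planar n P K" unfolding K_def using pl by (rule planar_mono) blast
  have axK: "\<forall>s\<in>K. axis s" using planar_axis[OF plK] by blast
  define M where "M = split_at (Suc j, r) K"
  define P' where "P' = insert (Suc j, r) P"
  define L' where "L' = insert ?f (insert ?e M)"
  have grid: "(Suc j, r) \<in> grid n - corners n" using j r by (auto simp: grid_def corners_def)
  have inP: "(0, r) \<in> P" "(j, r) \<in> P"
    using r j planar_subset[OF pl s(1)] unfolding stageD(2)[OF st] points_def margin_def by auto
  have plM: "planar n P' M" unfolding M_def P'_def by (rule planar_split[OF plK grid])
  have he: "horizontal ?e" and hf: "horizontal ?f" using j by (simp_all add: horizontal_pair)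
  have plE: "planar n P' (insert ?e M)"
    by (rule planar_insert[OF plM]) (use he inP pts(3) in \<open>auto simp: P'_def\<close>)
  have row_free: "(k, r) \<notin> P'" if k: "0 < k" "k < j" for k
  proof -
    have "(k, r) \<notin> P" using points_iff[of k r j lo hi] k j r unfolding stageD(2)[OF st] by auto
    then show ?thesis using k unfolding P'_def by simp
  qed
  \<comment> \<open>An old segment through \<open>(k, r)\<close> would cover a unit edge there. It
    is not horizontal, because the point of row \<open>r\<close> is in column \<open>j\<close> and
    the row has not been drawn, and not vertical, because column \<open>k\<close> has been
    cleared.\<close>
  have row_free': "(k, r) \<notin> pts s" if k: "0 < k" "k < j" and s: "s \<in> insert ?e M" for k s
  proof (cases "s = ?e")
    case True
    then show ?thesis using k pts(3) by simp
  next
    case False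
    then have "s \<in> split_at (Suc j, r) K" using s unfolding M_def by blast
    then obtain s' where s': "s' \<in> K" "pts s \<subseteq> pts s'" using axK by (rule split_at_source)
    then have s'L: "s' \<in> L" unfolding K_def by blast
    have noedge: "\<not> (p \<in> pts s' \<and> q \<in> pts s')" if "\<not> edge L p q" for p q
      using that s'L unfolding edge_def by blast
    have "(k, r) \<notin> pts s'"
      using planar_axis[OF pl s'L]
    proof (cases rule: axis_cases)
      case (horizontal a b y)
      have "\<not> edge L (k, r) (Suc k, r)" "\<not> edge L (k - 1, r) (Suc (k - 1), r)"
        using H r by simp_all
      from this[THEN noedge] show ?thesis
        unfolding horizontal(5) using horizontal(1) k(1) by (cases "k < b") auto
    next
      case (vertical y a b)
      have "\<not> edge L (k, r) (k, Suc r)" "\<not> edge L (k, r - 1) (k, Suc (r - 1))"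
        using V k by simp_all
      from this[THEN noedge] show ?thesis
        unfolding vertical(5) using vertical(1) r(1) by (cases "r < b") auto
    qed
    then show ?thesis using s'(2) by blast
  qed
  have plL': "planar n P' L'"
    unfolding L'_def
  proof (rule planar_insert[OF plE])
    show "axis ?f" using hf by simp
    show "pts ?f \<inter> P' = ?f"
    proof -
      have "(k, r) \<in> P' \<longleftrightarrow> k = 0 \<or> k = j" if "k \<le> j" for k
        using row_free[of k] that inP unfolding P'_def by (cases "k = 0 \<or> k = j") auto
      then show ?thesis unfolding pts by auto
    qed
    fix t assume "t \<in> insert ?e M"
    have "(k, r) \<in> P'" if "k \<le> j" "(k, r) \<in> pts t" for k
      using row_free'[OF _ _ \<open>t \<in> insert ?e M\<close>, of k] that inP unfolding P'_def
      by (cases "k = 0 \<or> k = j") auto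
    then show "pts ?f \<inter> pts t \<subseteq> P'" unfolding pts by auto
  qed
  have edgeK: "edge K p q \<longleftrightarrow> edge L p q \<and> \<not> (p \<in> pts ?s1 \<and> q \<in> pts ?s1) \<and> \<not> (p \<in> pts ?s2 \<and> q \<in> pts ?s2)"
    if "p \<noteq> q" for p q
  proof -
    have K: "K = (L - {?s1}) - {?s2}" unfolding K_def by blast
    have "planar n P (L - {?s1})" using pl by (rule planar_mono) blast
    moreover have "?s2 \<in> L - {?s1}" using s(2) \<open>?s1 \<noteq> ?s2\<close> by simp
    ultimately show ?thesis
      unfolding K using edge_remove[OF _ _ that] edge_remove[OF pl s(1) that] by blast
  qed
  have st': "stage (Suc j) 0 (Suc n) (P', L')"
    unfolding stage_def prod.case
  proof (intro conjI allI)
    show "planar n P' L'" by (rule plL')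
    show "P' = points (Suc j) 0 (Suc n)"
    proof (rule set_eqI)
      fix q :: point
      obtain k y where q: "q = (k, y)" by (cases q)
      have "x y = j \<longleftrightarrow> y = r" if "y \<in> {1..n}" using x_eq_iff[of y j] that j unfolding r_def by simp
      then have "y \<in> {1..n} \<and> x y < k \<and> (k \<le> Suc j \<or> k = Suc (Suc j) \<and> (y \<le> 0 \<or> Suc n \<le> y)) \<longleftrightarrow>
          y \<in> {1..n} \<and> x y < k \<and> (k \<le> j \<or> k = Suc j \<and> (y \<le> lo \<or> hi \<le> y)) \<or> k = Suc j \<and> y = r"
        using key[of y] r c by (cases "k = Suc j") auto
      then show "q \<in> P' \<longleftrightarrow> q \<in> points (Suc j) 0 (Suc n)"
        unfolding P'_def stageD(2)[OF st] points_def q Un_iff insert_iff mem_Collect_eq prod.case prod.inject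
        by blast
    qed
    fix k y
    have "edge M (k, y) (Suc k, y) \<longleftrightarrow> edge L (k, y) (Suc k, y)"
      unfolding M_def by (subst edge_split[OF axK]) (simp_all add: edgeK pts)
    then have "edge L' (k, y) (Suc k, y) \<longleftrightarrow> edge L (k, y) (Suc k, y) \<or> k \<le> j \<and> y = r"
      unfolding L'_def edge_insert pts by auto
    moreover have "1 \<le> y \<Longrightarrow> y \<le> n \<Longrightarrow> x y = j \<longleftrightarrow> y = r" using x_eq_iff[of y j] j unfolding r_def by simp
    ultimately show "edge L' (k, y) (Suc k, y) \<longleftrightarrow> 1 \<le> y \<and> y \<le> n \<and> x y < Suc j \<and>
        (k < Suc j \<or> k = Suc j \<and> (y \<le> 0 \<or> Suc n \<le> y))"
      unfolding H using key[of y] r c by (cases "y = r"; cases "k = j") auto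
    have "edge M (k, y) (k, Suc y) \<longleftrightarrow> edge L (k, y) (k, Suc y) \<and> \<not> (k = j \<and> lo \<le> y \<and> y < hi)"
      unfolding M_def by (subst edge_split[OF axK]) (use c in \<open>auto simp: edgeK pts\<close>)
    then have "edge L' (k, y) (k, Suc y) \<longleftrightarrow> edge L (k, y) (k, Suc y) \<and> \<not> (k = j \<and> lo \<le> y \<and> y < hi)"
      unfolding L'_def edge_insert pts by auto
    then show "edge L' (k, y) (k, Suc y) \<longleftrightarrow>
        1 \<le> k \<and> k \<le> n \<and> y \<le> n \<and> (Suc j < k \<or> k = Suc j \<and> 0 \<le> y \<and> y < Suc n)"
      unfolding V by auto
  qed
  \<comment> \<open>The end \<open>(0, r)\<close> is a margin point and already in \<open>P\<close>,
    so only the cut at \<open>(Suc j, r)\<close> can have an effect.\<close>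
  have L'_eq: "L' = split_at (Suc j, r) (split_at (0, r) (K \<union> {?f, ?e}))"
  proof -
    have f: "{(0, r), (j, r)} = ?f" by simp
    have "split_at (0, r) (K \<union> {?f, ?e}) = K \<union> {?f, ?e}"
    proof (rule split_at_id)
      fix s assume "s \<in> K \<union> {?f, ?e}"
      then have "s \<in> K \<or> s = ?f \<or> s = ?e" by blast
      then show "(0, r) \<notin> inner s"
        using planar_not_inner[OF plK inP(1)] endpoint_not_inner[of "(0, r)" ?f] pts(3)
        unfolding inner_def by auto
    qed
    also have "K \<union> {?f, ?e} = {?f} \<union> ({?e} \<union> K)" by blast
    finally have *: "split_at (0, r) (K \<union> {?f, ?e}) = {?f} \<union> ({?e} \<union> K)" .
    have "split_at (Suc j, r) {?f} = {?f}" "split_at (Suc j, r) {?e} = {?e}"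
      using pts(3,4) by (simp_all add: split_at_outside inner_def)
    then show ?thesis unfolding L'_def M_def * unfolding split_at_Un by (simp add: insert_commute)
  qed
  have "vertical ?s1" "vertical ?s2" using c by (simp_all add: vertical_pair)
  then have ori: "same_orientation ?s1 ?s2" "other_orientation ?s1 ?f" "other_orientation ?s1 ?e"
    using he hf by (simp_all add: same_orientation_def other_orientation_def)
  have "valid n (P, L)" by (rule stage_valid[OF st _ j(1)]) (use c in \<open>simp add: r_def\<close>)
  moreover have "valid n (P', L')"
  proof (rule stage_valid[OF st'])
    assume "Suc j \<le> n"
    then show "0 < row (Suc j) \<and> row (Suc j) < Suc n" using row[of "Suc j"] by simp
  qed simp
  moreover have "P' = P \<union> {(0, r), (Suc j, r)}" using inP(1) unfolding P'_def by blast
  ultimately have "A_flip n (P, L) (P', L')"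
    unfolding A_flip_def prod.case using s ori L'_eq c unfolding K_def
    by (intro conjI exI[of _ "(j, lo)"] exI[of _ "(j, r)"] exI[of _ "(j, hi)"]
        exI[of _ "(0, r)"] exI[of _ "(Suc j, r)"]) simp_all
  with st' show ?thesis by blast
qed

text \<open>Each rotation shrinks the interval from \<open>lo\<close> to \<open>hi\<close>. That
  \<open>(j, lo)\<close> and \<open>(j, hi)\<close> belong to \<open>P\<close> makes the outermost
  vertical segments end exactly there; when both have the point of \<open>X\<close> as inner end,
  the flip finishes the column.\<close>

lemma clear_column:
  assumes "stage j lo hi (P, L)" "1 \<le> j" "j \<le> n" "lo < row j" "row j < hi" "hi \<le> Suc n"
    "(j, lo) \<in> P" "(j, hi) \<in> P"
  shows "\<exists>R. (A_step n)\<^sup>*\<^sup>* (P, L) R \<and> stage (Suc j) 0 (Suc n) R"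
  using assms
proof (induction "hi - lo" arbitrary: lo hi P L rule: less_induct)
  case less
  note st = less.prems(1) and j = less.prems(2,3) and c = less.prems(4-6)
  note pl = stageD(1)[OF st] and V = stageD(4)[OF st]
  have axL: "\<forall>s\<in>L. axis s" using planar_axis[OF pl] by blast
  have r: "1 \<le> row j" "row j \<le> n" "x (row j) = j" using row[OF j] by simp_all
  have rP: "(j, row j) \<in> P"
    using points_iff[OF j r(1,2), of j lo hi] r(3) unfolding stageD(2)[OF st] by simp
  have "edge L (j, lo) (j, Suc lo)" unfolding V using j c by simp
  then obtain a b where ab: "{(j, a), (j, b)} \<in> L" "a \<le> lo" "lo < b"
    unfolding edge_vertical_iff[OF axL] by blast
  have "(j, lo) \<in> pts {(j, a), (j, b)}" using ab by (simp add: pts_vertical)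
  then have "(j, lo) \<in> {(j, a), (j, b)}" using planar_endpoint[OF pl ab(1) less.prems(7)] by blast
  then have s1: "{(j, lo), (j, b)} \<in> L" using ab by auto
  \<comment> \<open>The point of \<open>X\<close> belongs to \<open>P\<close>, so a segment starting
    below it cannot run past it.\<close>
  have b: "b \<le> row j"
  proof (rule ccontr)
    assume "\<not> b \<le> row j"
    then have "(j, row j) \<in> pts {(j, lo), (j, b)}" using c by (simp add: pts_vertical)
    then have "(j, row j) \<in> {(j, lo), (j, b)}" using planar_endpoint[OF pl s1 rP] by blast
    then show False using c \<open>\<not> b \<le> row j\<close> by simp
  qed
  \<comment> \<open>This names the topmost vertical unit edge of the column, from height
    \<open>h\<close> to \<open>hi\<close>.\<close>
  obtain h where h: "hi = Suc h" using c by (cases hi) auto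
  have "edge L (j, h) (j, Suc h)" unfolding V using j c h by simp
  then obtain d e where de: "{(j, d), (j, e)} \<in> L" "d \<le> h" "h < e"
    unfolding edge_vertical_iff[OF axL] by blast
  have "(j, hi) \<in> pts {(j, d), (j, e)}" using de h by (simp add: pts_vertical)
  then have "(j, hi) \<in> {(j, d), (j, e)}" using planar_endpoint[OF pl de(1) less.prems(8)] by blast
  then have s2: "{(j, d), (j, hi)} \<in> L" and "d < hi" using de h by auto
  have d: "row j \<le> d"
  proof (rule ccontr)
    assume "\<not> row j \<le> d"
    then have "(j, row j) \<in> pts {(j, d), (j, hi)}" using c by (simp add: pts_vertical)
    then have "(j, row j) \<in> {(j, d), (j, hi)}" using planar_endpoint[OF pl s2 rP] by blast
    then show False using c \<open>\<not> row j \<le> d\<close> by simp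
  qed
  have step: ?case
    if rot: "A_rotate n (P, L) (P', L')" and st': "stage j lo' hi' (P', L')"
      and m: "hi' - lo' < hi - lo" "lo' < row j" "row j < hi'" "hi' \<le> Suc n"
      and ends: "(j, lo') \<in> P" "(j, hi') \<in> P" for P' L' lo' hi'
  proof -
    have "P \<subseteq> P'" using rot by (auto simp: A_rotate_def)
    then obtain R where "(A_step n)\<^sup>*\<^sup>* (P', L') R" "stage (Suc j) 0 (Suc n) R"
      using less.hyps[OF m(1) st' j m(2-4)] ends by blast
    moreover have "A_step n (P, L) (P', L')" using rot by (simp add: A_step_def)
    ultimately show ?thesis by (meson converse_rtranclp_into_rtranclp)
  qed
  consider "b < row j" | "row j < d" | "b = row j" "d = row j" using b d by linarith
  then show ?case
  proof cases
    case 1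
    have "{(j, b), (j, lo)} \<in> L" using s1 by (simp add: insert_commute)
    then obtain P' L' where "A_rotate n (P, L) (P', L')" "stage j b hi (P', L')"
      using stage_rotate[OF st j c, of b lo b hi] 1 ab(3) by blast
    moreover have "(j, b) \<in> P" using planar_subset[OF pl s1] by simp
    ultimately show ?thesis using step 1 c ab(3) less.prems(8) by simp
  next
    case 2
    then obtain P' L' where "A_rotate n (P, L) (P', L')" "stage j lo d (P', L')"
      using stage_rotate[OF st j c s2, of lo d] \<open>d < hi\<close> by blast
    moreover have "(j, d) \<in> P" using planar_subset[OF pl s2] by simp
    ultimately show ?thesis using step 2 c \<open>d < hi\<close> less.prems(7) by simp
  next
    case 3
    then obtain P' L' where "A_flip n (P, L) (P', L')" "stage (Suc j) 0 (Suc n) (P', L')"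
      using stage_flip[OF st j c] s1 s2 by blast
    then show ?thesis unfolding A_step_def by blast
  qed
qed

lemma stage_reachable:
  "j \<le> n \<Longrightarrow> \<exists>R. (A_step n)\<^sup>*\<^sup>* (initial_state n X) R \<and> stage (Suc j) 0 (Suc n) R"
proof (induction j)
  case 0
  show ?case using initial_stage by (intro exI[of _ "initial_state n X"]) simp
next
  case (Suc j)
  then obtain P L where R: "(A_step n)\<^sup>*\<^sup>* (initial_state n X) (P, L)" "stage (Suc j) 0 (Suc n) (P, L)"
    by auto
  have "(Suc j, 0) \<in> P" "(Suc j, Suc n) \<in> P"
    using Suc.prems unfolding stageD(2)[OF R(2)] points_def margin_def by auto
  then have "\<exists>R. (A_step n)\<^sup>*\<^sup>* (P, L) R \<and> stage (Suc (Suc j)) 0 (Suc n) R"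
    using row[of "Suc j"] Suc.prems by (intro clear_column[OF R(2)]) auto
  then show ?case using R(1) by (meson rtranclp_trans)
qed

lemma end_state_reachable: "\<exists>R. (A_step n)\<^sup>*\<^sup>* (initial_state n X) R \<and> end_state n X R"
  using stage_reachable[of n] final_stage by (metis order_refl prod.collapse)

end

theorem theorem7:
  fixes n :: nat and X :: "point set"
  assumes "permutation_points n X"
  shows "OPT_R n X \<le> 2 * diam n X"
proof -
  obtain x where x: "bij_betw x {1..n} {1..n}" "X = {(x i, i) | i. i \<in> {1..n}}"
    using assms unfolding permutation_points_def by blast
  interpret column_sweep n x by unfold_locales (rule x(1))
  have X: "column_sweep.X n x = X" using x(2) unfolding X_def ..
  obtain R where R: "(A_step n)\<^sup>*\<^sup>* (initial_state n X) R" "end_state n X R"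
    using end_state_reachable unfolding X by blast
  let ?D = "{enat k | k. (A_step n ^^ k) (initial_state n X) R}"
  obtain k0 where "(A_step n ^^ k0) (initial_state n X) R" using R(1) by (auto simp: rtranclp_power)
  then have "enat k0 \<in> ?D" by blast
  \<comment> \<open>A nonempty set of extended naturals attains its infimum, so the distance is
    realised by an actual sequence of operations.\<close>
  then have "Inf ?D \<in> ?D" by (rule wellorder_InfI)
  then obtain k where k: "A_dist n (initial_state n X) R = enat k"
    "(A_step n ^^ k) (initial_state n X) R" unfolding A_dist_def by blast
  obtain m where m: "m \<le> 2 * k" "(flip_step n ^^ m) (initial_state n X) R"
    using A_steps_flip_steps[OF k(2)] by blast
  have "OPT_R n X \<le> enat m" unfolding OPT_R_def using m(2) R(2) by (intro Inf_lower) blast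
  also have "\<dots> \<le> 2 * enat k" using m(1) by (simp add: numeral_eq_enat)
  \<comment> \<open>The initial state is reachable from itself, so together with \<open>R\<close> it
    is one of the pairs over which the diameter is taken.\<close>
  also have "enat k \<le> diam n X"
    unfolding diam_def k(1)[symmetric] using R(1) by (intro Sup_upper) blast
  then have "2 * enat k \<le> 2 * diam n X" by (intro mult_left_mono) simp_all
  finally show ?thesis .
qed

end
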